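(* Let $F=\frac1n\sum_{i=1}^nF_i$ where each $F_i:\mathbb{R}^d\to\mathbb{R}^d$ is $L$-Lipschitz ($L>0$), and let $F$ be monotone. Run DecPolyakSEG with $\gamma_{-1}>0$, $c_{-1}=1$, $c_k=\sqrt{k+1}$ for $k\ge 0$, and $\gamma_k>0$ satisfying, for all $k\ge 0$, $\gamma_k\le\frac{c_{k-1}}{c_k}\gamma_{k-1}$ and the stochastic critical condition $$\|F_{\mathcal S_k}(\hat x_k)-F_{\mathcal S_k}(x_k)\|\le A\|F_{\mathcal S_k}(x_k)\|$$ with a fixed $A\in(0,1)$. Assume there is a compact convex set $\mathcal C\subseteq\mathbb{R}^d$ with diameter $D$, containing a zero $x_*$ of $F$, such that $x_k,\hat x_k\in\mathcal C$ throughout the run. Suppose that for some $\underline\gamma>0$, almost surely, $$\gamma_k\ge\frac{\underline\gamma}{\sqrt{k+1}}\qquad\text{for all }k=0,1,\dots\tag{$\ast$}$$ Then, for every $K\ge 0$, $\overline x_K:=\frac1{K+1}\sum_{k=0}^K\hat x_k$ satisfies $$\mathbb{E}\left[\|F(\overline x_K)\|^2\right]\le\frac{4L}{\sqrt{K+1}}\left[\frac{9(1+A)D^2}{8\underline\gamma}+\frac{3\sigma D}{2}+\frac{2\gamma_{-1}}{1-A}\left(\sigma^2+9L^2D^2\right)\right]=\mathcal O\left(\frac1{\sqrt{K+1}}\right),$$ where $\sigma\ge 0$ is given by $\sigma^2=2L^2D^2+2\,\mathbb{E}_{\mathcal S}[\|F_{\mathcal S}(x_* )\|^2]$. Moreover,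 condition $(\ast)$ holds in both of the following cases: 1. $\gamma_{-1}=\frac AL$ and $\gamma_k=\frac{A}{L\sqrt{k+1}}$ for $k\ge 0$, with $\underline\gamma=\frac AL$. 2. The step-sizes $\gamma_k$ are those generated by DecPolyakSEG-LS with $c_{-1}=1$, $c_k=\sqrt{k+1}$ for $k\ge0$, initial step-size $\gamma_{-1}>0$ and line-search factor $\beta>1$, with $\underline\gamma=\min\left\{\gamma_{-1},\frac{A}{\beta L}\right\}$.
   Context: $\langle\cdot,\cdot\rangle$ and $\|\cdot\|$ are Euclidean; $[n]=\{1,\dots,n\}$. $G$ is monotone if $\langle G(x)-G(y),x-y\rangle\ge 0$ for all $x,y$; $G$ is $L$-Lipschitz if $\|G(x)-G(y)\|\le L\|x-y\|$ for all $x,y$. For a mini-batch $\mathcal S$ of indices from $[n]$, $F_{\mathcal S}=\frac1{|\mathcal S|}\sum_{i\in\mathcal S}F_i$. At each iteration $k$ a mini-batch $\mathcal S_k$ is drawn from $[n]$ uniformly with replacement, independently of the past and with the same distribution for all $k$, so that $\mathbb{E}_{\mathcal S}[F_{\mathcal S}(x)]=F(x)$; $\mathbb{E}_{\mathcal S}$ is expectation over a mini-batch with this distribution. The step-size $\gamma_k$ may depend on the past and on $\mathcal S_k$, but not on future samples; $\gamma_{-1}$ and $x_0$ are deterministic. DecPolyakSEG: given $x_0\in\mathbb{R}^d$, a non-decreasing positive sequence $\{c_k\}_{k\ge -1}$, and $\gamma_k$ with $0<\gamma_k\le\frac{c_{k-1}}{c_k}\gamma_{k-1}$ for $k\ge 0$,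 set $\alpha_{-1}=\infty$ and for $k=0,1,\dots$: sample $\mathcal S_k$ and set $$\hat x_k=x_k-\gamma_kF_{\mathcal S_k}(x_k),\quad\alpha_k=\min\left\{\frac{\langle F_{\mathcal S_k}(\hat x_k),x_k-\hat x_k\rangle}{\|F_{\mathcal S_k}(\hat x_k)\|^2},\alpha_{k-1}\right\},\quad x_{k+1}=x_k-\alpha_kF_{\mathcal S_k}(\hat x_k).$$ Convention: if $F_{\mathcal S_k}(\hat x_k)=0$, set $\alpha_k=\min\{\alpha_{k-1},\gamma_k\}$, so that $x_{k+1}=x_k$. DecPolyakSEG-LS is DecPolyakSEG with $\gamma_k$ selected by backtracking: given $\gamma_{-1}>0$, $\beta>1$, $A\in(0,1)$, at iteration $k$ start from $\gamma_k=\frac{c_{k-1}}{c_k}\gamma_{k-1}$, sample $\mathcal S_k$, set $\hat x_k=x_k-\gamma_kF_{\mathcal S_k}(x_k)$, and while $\|F_{\mathcal S_k}(x_k)-F_{\mathcal S_k}(\hat x_k)\|>A\|F_{\mathcal S_k}(x_k)\|$ replace $\gamma_k$ by $\gamma_k/\beta$ and recompute $\hat x_k=x_k-\gamma_kF_{\mathcal S_k}(x_k)$; then compute $\alpha_k$ and $x_{k+1}$ as in DecPolyakSEG. *)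

theory Defs
  imports "HOL-Probability.Probability" "HOL-Library.While_Combinator" "HOL-Library.Landau_Symbols"
begin

definition monotone_operator :: "('v::real_inner \<Rightarrow> 'v) \<Rightarrow> bool" where
  "monotone_operator G \<longleftrightarrow> (\<forall>x y. (G x - G y) \<bullet> (x - y) \<ge> 0)"

text \<open>Mini-batches of size b from \<open>{1..n}\<close>. They are lists rather than sets, since sampling is with
  replacement; b independent uniform draws amount to the uniform distribution on this set.\<close>

definition batches :: "nat \<Rightarrow> nat \<Rightarrow> nat list set" where
  "batches n b = {s. length s = b \<and> set s \<subseteq> {1..n}}"

definition batch_op :: "(nat \<Rightarrow> 'v \<Rightarrow> 'v) \<Rightarrow> nat list \<Rightarrow> 'v \<Rightarrow> 'v::real_vector" where
  "batch_op Fi s x = (1 / real (length s)) *\<^sub>R (\<Sum>i\<leftarrow>s. Fi i x)"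

text \<open>The term with index k - 1 of the sequence s, whose term with index -1 is a.\<close>

definition prev :: "'b \<Rightarrow> (nat \<Rightarrow> 'b) \<Rightarrow> nat \<Rightarrow> 'b" where
  "prev a s k = (case k of 0 \<Rightarrow> a | Suc j \<Rightarrow> s j)"

text \<open>One realisation of the iteration: \<open>G k\<close> is the operator of the mini-batch sampled at step k.
  The values of \<open>\<alpha>\<close> are extended reals because its term with index -1 is \<open>\<infinity>\<close>.
  They are finite from index 0 on.\<close>

definition polyak_seg_iterates ::
  "(nat \<Rightarrow> 'v \<Rightarrow> 'v::real_inner) \<Rightarrow> (nat \<Rightarrow> real) \<Rightarrow> 'v \<Rightarrow>
   (nat \<Rightarrow> 'v) \<Rightarrow> (nat \<Rightarrow> 'v) \<Rightarrow> (nat \<Rightarrow> ereal) \<Rightarrow> bool" where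
  "polyak_seg_iterates G \<gamma> x0 x xh \<alpha> \<longleftrightarrow>
     x 0 = x0 \<and>
     (\<forall>k. xh k = x k - \<gamma> k *\<^sub>R G k (x k) \<and>
          \<alpha> k = min (ereal (if G k (xh k) = 0 then \<gamma> k
                            else (G k (xh k) \<bullet> (x k - xh k)) / (norm (G k (xh k)))\<^sup>2))
                     (prev \<infinity> \<alpha> k) \<and>
          x (Suc k) = x k - real_of_ereal (\<alpha> k) *\<^sub>R G k (xh k))"

text \<open>The arguments \<open>cm1\<close> and \<open>\<gamma>m1\<close> are the terms with index -1 of \<open>c\<close> and \<open>\<gamma>\<close>.\<close>

definition dec_polyak_seg ::
  "real \<Rightarrow> (nat \<Rightarrow> real) \<Rightarrow> real \<Rightarrow> (nat \<Rightarrow> 'v \<Rightarrow> 'v::real_inner) \<Rightarrow> (nat \<Rightarrow> real) \<Rightarrow> 'v \<Rightarrow>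
   (nat \<Rightarrow> 'v) \<Rightarrow> (nat \<Rightarrow> 'v) \<Rightarrow> (nat \<Rightarrow> ereal) \<Rightarrow> bool" where
  "dec_polyak_seg cm1 c \<gamma>m1 G \<gamma> x0 x xh \<alpha> \<longleftrightarrow>
     polyak_seg_iterates G \<gamma> x0 x xh \<alpha> \<and>
     (\<forall>k. 0 < \<gamma> k \<and> \<gamma> k \<le> prev cm1 c k / c k * prev \<gamma>m1 \<gamma> k)"

definition critical_condition ::
  "real \<Rightarrow> (nat \<Rightarrow> 'v \<Rightarrow> 'v::real_normed_vector) \<Rightarrow> (nat \<Rightarrow> 'v) \<Rightarrow> (nat \<Rightarrow> 'v) \<Rightarrow> bool" where
  "critical_condition A G x xh \<longleftrightarrow>
     (\<forall>k. norm (G k (xh k) - G k (x k)) \<le> A * norm (G k (x k)))"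

definition backtrack ::
  "real \<Rightarrow> real \<Rightarrow> ('v \<Rightarrow> 'v::real_normed_vector) \<Rightarrow> 'v \<Rightarrow> real \<Rightarrow> real" where
  "backtrack \<beta> A G x g0 =
     while (\<lambda>g. norm (G x - G (x - g *\<^sub>R G x)) > A * norm (G x)) (\<lambda>g. g / \<beta>) g0"

definition dec_polyak_seg_ls ::
  "real \<Rightarrow> real \<Rightarrow> real \<Rightarrow> (nat \<Rightarrow> real) \<Rightarrow> real \<Rightarrow> (nat \<Rightarrow> 'v \<Rightarrow> 'v::real_inner) \<Rightarrow> (nat \<Rightarrow> real) \<Rightarrow> 'v \<Rightarrow>
   (nat \<Rightarrow> 'v) \<Rightarrow> (nat \<Rightarrow> 'v) \<Rightarrow> (nat \<Rightarrow> ereal) \<Rightarrow> bool" where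
  "dec_polyak_seg_ls \<beta> A cm1 c \<gamma>m1 G \<gamma> x0 x xh \<alpha> \<longleftrightarrow>
     polyak_seg_iterates G \<gamma> x0 x xh \<alpha> \<and>
     (\<forall>k. \<gamma> k = backtrack \<beta> A (G k) (x k) (prev cm1 c k / c k * prev \<gamma>m1 \<gamma> k))"

text \<open>\<open>\<F> k\<close> is the information available before step k: the sample \<open>S k\<close> is independent of it, while
  \<open>S k\<close> and whatever is computed in step k from \<open>S k\<close> and the past is measurable for \<open>\<F> (Suc k)\<close>.\<close>

definition batch_sampling ::
  "'w measure \<Rightarrow> (nat \<Rightarrow> 'w measure) \<Rightarrow> nat \<Rightarrow> nat \<Rightarrow> (nat \<Rightarrow> 'w \<Rightarrow> nat list) \<Rightarrow> bool" where
  "batch_sampling M \<F> n b S \<longleftrightarrow>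
     prob_space M \<and> filtration (space M) \<F> \<and>
     (\<forall>k. subalgebra M (\<F> k) \<and>
          S k \<in> \<F> (Suc k) \<rightarrow>\<^sub>M count_space (batches n b) \<and>
          distr M (count_space (batches n b)) (S k) = uniform_count_measure (batches n b) \<and>
          prob_space.indep_set M (sets (\<F> k)) {S k -` B \<inter> space M | B. B \<subseteq> batches n b})"

end

theory Submission
  imports Defs
begin

text \<open>Write \<open>G\<^sub>k\<close> for the operator of the batch drawn in step \<open>k\<close>. The critical condition gives
  \<open>\<gamma>\<^sub>k / (1 + A) \<le> \<alpha>\<^sub>k\<close>, and \<open>\<alpha>\<^sub>k\<close> is at most the Polyak step, which is the one that makes the
  update a projection. Hence every run has small regret against every comparison point \<open>u\<close>:
  the sum of \<open>G\<^sub>k (xh\<^sub>k) \<bullet> (xh\<^sub>k - u)\<close> over \<open>k \<le> K\<close> is of order \<open>1 / \<gamma>\<^sub>K\<close>, because the squared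
  distances to \<open>u\<close> telescope after division by the decreasing \<open>\<alpha>\<^sub>k\<close> (\<open>polyak_regret\<close>).

  To turn regret into a bound on \<open>F z\<close> at the average \<open>z\<close> of the \<open>xh\<^sub>k\<close>, compare with
  \<open>u = z - F z / (2 L)\<close>. Then \<open>(norm (F z))\<^sup>2 \<le> 4 L (F u \<bullet> (z - u))\<close> by the Lipschitz bound, and
  monotonicity of \<open>F\<close> bounds \<open>F u \<bullet> (z - u)\<close> by the average of \<open>F (xh\<^sub>k) \<bullet> (xh\<^sub>k - u)\<close>. The point \<open>u\<close>
  need not lie in the compact set, but it is within \<open>3 D / 2\<close> of each of its points.

  What remains is to replace \<open>F\<close> by \<open>G\<^sub>k\<close> at \<open>xh\<^sub>k\<close>, which itself depends on the batch. The noise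
  \<open>e\<^sub>k = F (x\<^sub>k) - G\<^sub>k (x\<^sub>k)\<close> at \<open>x\<^sub>k\<close> has conditional mean zero; moving from \<open>x\<^sub>k\<close> to \<open>xh\<^sub>k\<close> costs a
  multiple of \<open>\<gamma>\<^sub>k\<close>, and these costs add up to order \<open>\<surd>K\<close>. Since \<open>u\<close> depends on the whole run,
  \<open>e\<^sub>k \<bullet> (x\<^sub>k - u)\<close> is split at the deterministic point \<open>x\<^sub>0\<close>: the part \<open>e\<^sub>k \<bullet> (x\<^sub>k - x\<^sub>0)\<close> has mean zero,
  and the sum of the \<open>e\<^sub>k \<bullet> (x\<^sub>0 - u)\<close> is at most \<open>3 D / 2\<close> times the norm of the sum of the \<open>e\<^sub>k\<close>, which
  by orthogonality has mean at most \<open>\<sigma> \<surd>(K + 1)\<close>. This is carried out for a single run in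
  \<open>residual_pathwise_bound\<close> and in expectation in \<open>expected_residual\<close>.

  A step of size at most \<open>A / L\<close> always meets the critical condition. This makes the explicit
  step-size rule admissible, and it keeps the line search from going below \<open>A / (\<beta> L)\<close> unless the
  proposed step is already smaller.\<close>

section \<open>Averages over mini-batches\<close>

lemma finite_batches [simp]: "finite (batches n b)"
proof -
  have "batches n b = {s. set s \<subseteq> {1..n} \<and> length s = b}"
    by (auto simp: batches_def)
  then show ?thesis
    by (simp add: finite_lists_length_eq)
qed

lemma card_batches: "card (batches n b) = n ^ b"
proof -
  have "batches n b = {s. set s \<subseteq> {1..n} \<and> length s = b}"
    by (auto simp: batches_def)
  then show ?thesis
    by (simp add: card_lists_length_eq)
qed

lemma batches_Suc: "batches n (Suc b) = (\<lambda>(i, s). i # s) ` ({1..n} \<times> batches n b)"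
proof (intro set_eqI iffI)
  fix t assume "t \<in> batches n (Suc b)"
  then show "t \<in> (\<lambda>(i, s). i # s) ` ({1..n} \<times> batches n b)"
    by (cases t) (auto simp: batches_def)
qed (auto simp: batches_def)

text \<open>By symmetry every index fills each of the \<open>b\<close> positions of a batch equally often. Both sides
  carry a factor \<open>n\<close>, so that no truncated exponent \<open>b - 1\<close> occurs.\<close>

lemma sum_batches_sum_list:
  fixes v :: "nat \<Rightarrow> 'v::real_vector"
  shows "real n *\<^sub>R (\<Sum>s\<in>batches n b. \<Sum>i\<leftarrow>s. v i) = (real b * real n ^ b) *\<^sub>R (\<Sum>i=1..n. v i)"
proof (induction b)
  case 0
  have "batches n 0 = {[]}" by (auto simp: batches_def)
  then show ?case by simp
next
  case (Suc b)
  have inj: "inj_on (\<lambda>(i, s). i # s) ({1..n} \<times> batches n b)"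
    by (auto simp: inj_on_def)
  have "(\<Sum>s\<in>batches n (Suc b). \<Sum>i\<leftarrow>s. v i)
      = (\<Sum>(i, s)\<in>{1..n} \<times> batches n b. v i + (\<Sum>j\<leftarrow>s. v j))"
    unfolding batches_Suc by (subst sum.reindex[OF inj]) (simp add: case_prod_beta)
  also have "\<dots> = (\<Sum>i=1..n. \<Sum>s\<in>batches n b. v i + (\<Sum>j\<leftarrow>s. v j))"
    by (simp add: sum.cartesian_product)
  also have "\<dots> = real n ^ b *\<^sub>R (\<Sum>i=1..n. v i) + real n *\<^sub>R (\<Sum>s\<in>batches n b. \<Sum>j\<leftarrow>s. v j)"
    unfolding sum.distrib sum_constant_scaleR card_batches scaleR_sum_right by simp
  also have "\<dots> = (real (Suc b) * real n ^ b) *\<^sub>R (\<Sum>i=1..n. v i)"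
    unfolding Suc.IH scaleR_add_left[symmetric] by (simp add: distrib_right)
  finally show ?case
    by (simp add: algebra_simps)
qed

lemma batch_op_unbiased:
  fixes Fi :: "nat \<Rightarrow> 'v \<Rightarrow> 'v::real_vector"
  assumes "n \<ge> 1" "b \<ge> 1"
  shows "(1 / real (n ^ b)) *\<^sub>R (\<Sum>s\<in>batches n b. batch_op Fi s y) = (1 / real n) *\<^sub>R (\<Sum>i=1..n. Fi i y)"
proof -
  have "(\<Sum>s\<in>batches n b. batch_op Fi s y) = (1 / real b) *\<^sub>R (\<Sum>s\<in>batches n b. \<Sum>i\<leftarrow>s. Fi i y)"
    unfolding scaleR_sum_right by (intro sum.cong) (auto simp: batch_op_def batches_def)
  also have "(\<Sum>s\<in>batches n b. \<Sum>i\<leftarrow>s. Fi i y) =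
      (1 / real n) *\<^sub>R (real n *\<^sub>R (\<Sum>s\<in>batches n b. \<Sum>i\<leftarrow>s. Fi i y))"
    using assms by simp
  also have "\<dots> = (1 / real n) *\<^sub>R ((real b * real n ^ b) *\<^sub>R (\<Sum>i=1..n. Fi i y))"
    unfolding sum_batches_sum_list ..
  finally show ?thesis
    using assms by simp
qed

lemma norm_sum_list_diff_le:
  fixes Fi :: "nat \<Rightarrow> 'v \<Rightarrow> 'v::real_normed_vector"
  assumes "\<And>i. i \<in> set s \<Longrightarrow> norm (Fi i y - Fi i z) \<le> e"
  shows "norm ((\<Sum>i\<leftarrow>s. Fi i y) - (\<Sum>i\<leftarrow>s. Fi i z)) \<le> real (length s) * e"
  using assms
proof (induction s)
  case (Cons a s)
  have "norm ((\<Sum>i\<leftarrow>a # s. Fi i y) - (\<Sum>i\<leftarrow>a # s. Fi i z))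
      = norm ((Fi a y - Fi a z) + ((\<Sum>i\<leftarrow>s. Fi i y) - (\<Sum>i\<leftarrow>s. Fi i z)))"
    by (simp add: algebra_simps)
  also have "\<dots> \<le> e + real (length s) * e"
    using Cons by (intro norm_triangle_mono) auto
  finally show ?case by (simp add: algebra_simps)
qed simp

lemma batch_op_lipschitz:
  fixes Fi :: "nat \<Rightarrow> 'v \<Rightarrow> 'v::real_normed_vector"
  assumes "\<And>i. i \<in> {1..n} \<Longrightarrow> L-lipschitz_on UNIV (Fi i)" "s \<in> batches n b" "b \<ge> 1"
  shows "norm (batch_op Fi s y - batch_op Fi s z) \<le> L * norm (y - z)"
proof -
  have s: "length s = b" "set s \<subseteq> {1..n}" using assms by (auto simp: batches_def)
  have "norm ((\<Sum>i\<leftarrow>s. Fi i y) - (\<Sum>i\<leftarrow>s. Fi i z)) \<le> real (length s) * (L * norm (y - z))"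
    using s assms(1) by (intro norm_sum_list_diff_le) (auto simp: lipschitz_on_def dist_norm subset_iff)
  moreover have "batch_op Fi s y - batch_op Fi s z = (1 / real b) *\<^sub>R ((\<Sum>i\<leftarrow>s. Fi i y) - (\<Sum>i\<leftarrow>s. Fi i z))"
    using s by (simp add: batch_op_def scaleR_diff_right)
  ultimately show ?thesis
    using s \<open>b \<ge> 1\<close> by (simp add: pos_divide_le_eq mult_ac)
qed

section \<open>The backtracking line search\<close>

lemma backtrack_unfold:
  "backtrack \<beta> A G x g =
     (if norm (G x - G (x - g *\<^sub>R G x)) > A * norm (G x) then backtrack \<beta> A G x (g / \<beta>) else g)"
  unfolding backtrack_def by (subst while_unfold) simp

text \<open>This is the reason why the line search stops and why steps of size \<open>A / L\<close> need none.\<close>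

lemma lipschitz_step_critical:
  fixes G :: "'v \<Rightarrow> 'v::real_normed_vector"
  assumes "\<And>y z. norm (G y - G z) \<le> L * norm (y - z)" "L > 0" "0 \<le> g" "g \<le> A / L"
  shows "norm (G x - G (x - g *\<^sub>R G x)) \<le> A * norm (G x)"
proof -
  have "norm (G x - G (x - g *\<^sub>R G x)) \<le> L * norm (x - (x - g *\<^sub>R G x))"
    by (rule assms)
  also have "\<dots> = (L * g) * norm (G x)" using assms by simp
  also have "\<dots> \<le> A * norm (G x)"
    using assms by (intro mult_right_mono) (auto simp: field_simps)
  finally show ?thesis .
qed

text \<open>The induction is on the number of divisions by \<open>\<beta>\<close> that bring the step below \<open>A / L\<close>, where
  the loop has certainly stopped. A step that was rejected exceeds \<open>A / L\<close>, so that its successor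
  exceeds \<open>A / (\<beta> L)\<close>.\<close>

lemma backtrack_correct:
  fixes G :: "'v \<Rightarrow> 'v::real_normed_vector" and x :: 'v
  assumes lip: "\<And>y z. norm (G y - G z) \<le> L * norm (y - z)"
    and pos: "L > 0" "A > 0" "\<beta> > 1" "g > 0"
  defines "r \<equiv> backtrack \<beta> A G x g"
  shows "0 < r \<and> r \<le> g \<and> min g (A / (\<beta> * L)) \<le> r \<and>
    norm (G x - G (x - r *\<^sub>R G x)) \<le> A * norm (G x)"
proof -
  obtain m where "g / (A / L) < \<beta> ^ m"
    using real_arch_pow[OF \<open>\<beta> > 1\<close>] by blast
  then have "g \<le> A / L * \<beta> ^ m" using pos by (simp add: field_simps)
  then show ?thesis
    unfolding r_def using \<open>g > 0\<close>
  proof (induction m arbitrary: g)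
    case 0
    then have "norm (G x - G (x - g *\<^sub>R G x)) \<le> A * norm (G x)"
      using pos by (intro lipschitz_step_critical[OF lip]) auto
    then show ?case using 0 by (subst (1 2 3 4) backtrack_unfold) auto
  next
    case (Suc m)
    show ?case
    proof (cases "norm (G x - G (x - g *\<^sub>R G x)) > A * norm (G x)")
      case True
      let ?r = "backtrack \<beta> A G x (g / \<beta>)"
      have eq: "backtrack \<beta> A G x g = ?r" using True by (subst backtrack_unfold) simp
      have "g > A / L"
        using True lipschitz_step_critical[OF lip, of g A x] pos Suc.prems by force
      then have "A / (\<beta> * L) < g / \<beta>" using pos by (simp add: field_simps)
      moreover have "0 < ?r \<and> ?r \<le> g / \<beta> \<and> min (g / \<beta>) (A / (\<beta> * L)) \<le> ?r \<and>
          norm (G x - G (x - ?r *\<^sub>R G x)) \<le> A * norm (G x)"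
        using Suc.prems pos by (intro Suc.IH) (auto simp: field_simps)
      moreover have "g / \<beta> \<le> g" using pos Suc.prems by (simp add: field_simps)
      ultimately show ?thesis unfolding eq by auto
    next
      case False
      then show ?thesis using Suc.prems by (subst (1 2 3 4) backtrack_unfold) auto
    qed
  qed
qed

section \<open>Step-sizes along one run\<close>

text \<open>The rule \<open>\<gamma>\<^sub>k \<le> c\<^sub>k\<^sub>-\<^sub>1 / c\<^sub>k \<cdot> \<gamma>\<^sub>k\<^sub>-\<^sub>1\<close> says that \<open>c\<^sub>k \<gamma>\<^sub>k\<close> does not increase.\<close>

lemma dec_polyak_seg_step_upper:
  assumes c: "\<And>k. c k = sqrt (real k + 1)"
    and run: "dec_polyak_seg 1 c \<gamma>m1 G \<gamma> x0 x xh \<alpha>"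
  shows "\<gamma> k \<le> \<gamma>m1 / sqrt (real k + 1)"
proof -
  have step: "\<gamma> k \<le> prev 1 c k / c k * prev \<gamma>m1 \<gamma> k" for k
    using run by (simp add: dec_polyak_seg_def)
  have "c k * \<gamma> k \<le> \<gamma>m1"
  proof (induction k)
    case 0
    then show ?case using step[of 0] c by (simp add: prev_def)
  next
    case (Suc k)
    have "c (Suc k) * \<gamma> (Suc k) \<le> c k * \<gamma> k"
      using step[of "Suc k"] c[of "Suc k"] by (simp add: prev_def field_simps)
    with Suc show ?case by simp
  qed
  then show ?thesis using c by (simp add: field_simps)
qed

lemma dec_polyak_seg_step_decreasing:
  assumes c: "\<And>k. c k = sqrt (real k + 1)"
    and run: "dec_polyak_seg 1 c \<gamma>m1 G \<gamma> x0 x xh \<alpha>"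
  shows "\<gamma> (Suc k) \<le> \<gamma> k"
proof -
  have "\<gamma> (Suc k) \<le> c k / c (Suc k) * \<gamma> k" "\<gamma> k > 0"
    using run by (auto simp: dec_polyak_seg_def prev_def dest: spec[of _ "Suc k"])
  moreover have "c k / c (Suc k) \<le> 1" by (simp add: c)
  ultimately show ?thesis by (smt (verit) mult_left_le_one_le mult_less_cancel_right1)
qed

section \<open>Regret of one run\<close>

text \<open>Expanding \<open>(norm (h - g))\<^sup>2\<close> gives \<open>2 (h \<bullet> g) \<ge> (norm h)\<^sup>2 + (1 - A\<^sup>2) (norm g)\<^sup>2\<close>, and the last
  term is at least \<open>(1 - A) / (1 + A) \<cdot> (norm h)\<^sup>2\<close> because \<open>norm h \<le> (1 + A) norm g\<close>.\<close>

lemma critical_inner_lower: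
  fixes g h :: "'v::real_inner"
  assumes "norm (h - g) \<le> A * norm g" "0 < A" "A < 1"
  shows "(norm h)\<^sup>2 / (1 + A) \<le> h \<bullet> g"
proof -
  have 1: "(norm (h - g))\<^sup>2 \<le> A\<^sup>2 * (norm g)\<^sup>2"
    using power_mono[OF assms(1), of 2] by (simp add: power_mult_distrib)
  have "norm h \<le> norm (h - g) + norm g"
    by (metis diff_add_cancel norm_triangle_ineq)
  then have "norm h \<le> (1 + A) * norm g"
    using assms by (simp add: algebra_simps)
  then have 2: "(norm h)\<^sup>2 \<le> (1 + A)\<^sup>2 * (norm g)\<^sup>2"
    using power_mono[of "norm h" "(1 + A) * norm g" 2] by (simp add: power_mult_distrib)
  have "(norm (h - g))\<^sup>2 = (norm h)\<^sup>2 + (norm g)\<^sup>2 - 2 * (h \<bullet> g)"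
    by (simp add: power2_norm_eq_inner inner_diff inner_commute algebra_simps)
  with 1 have "(1 + A) * (2 * (h \<bullet> g)) \<ge> (1 + A) * ((norm h)\<^sup>2 + (1 - A\<^sup>2) * (norm g)\<^sup>2)"
    using assms by (intro mult_left_mono) (auto simp: algebra_simps)
  moreover have "(1 + A) * ((1 - A\<^sup>2) * (norm g)\<^sup>2) = (1 - A) * ((1 + A)\<^sup>2 * (norm g)\<^sup>2)"
    by (simp add: power2_eq_square algebra_simps)
  moreover have "\<dots> \<ge> (1 - A) * (norm h)\<^sup>2"
    using 2 assms by (intro mult_left_mono) auto
  ultimately have "(1 + A) * (2 * (h \<bullet> g)) \<ge> 2 * (norm h)\<^sup>2"
    by (simp add: algebra_simps)
  then show ?thesis using assms by (simp add: field_simps)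
qed

text \<open>The lower bound passes from the Polyak steps to their running minimum \<open>\<alpha>\<^sub>k\<close> because \<open>\<gamma>\<close>
  decreases. The last inequality says that \<open>\<alpha>\<^sub>k\<close> does not exceed the Polyak step.\<close>

lemma polyak_step_size:
  fixes G :: "nat \<Rightarrow> 'v \<Rightarrow> 'v::real_inner"
  assumes A: "0 < A" "A < 1"
    and it: "polyak_seg_iterates G \<gamma> x0 x xh \<alpha>"
    and pos: "\<And>k. \<gamma> k > 0" and dec: "\<And>k. \<gamma> (Suc k) \<le> \<gamma> k"
    and crit: "critical_condition A G x xh"
  defines "r \<equiv> \<lambda>k. real_of_ereal (\<alpha> k)"
  shows "r (Suc k) \<le> r k" "\<gamma> k / (1 + A) \<le> r k"
    "r k * (norm (G k (xh k)))\<^sup>2 \<le> G k (xh k) \<bullet> (x k - xh k)"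
proof -
  define t where "t k = (if G k (xh k) = 0 then \<gamma> k
      else (G k (xh k) \<bullet> (x k - xh k)) / (norm (G k (xh k)))\<^sup>2)" for k
  have \<alpha>: "\<alpha> k = min (ereal (t k)) (prev \<infinity> \<alpha> k)" and diff: "x k - xh k = \<gamma> k *\<^sub>R G k (x k)" for k
    using it by (auto simp: polyak_seg_iterates_def t_def)
  have fin: "\<alpha> k = ereal (r k)" for k
  proof (induction k)
    case 0
    then show ?case using \<alpha>[of 0] by (simp add: prev_def r_def)
  next
    case (Suc k)
    then show ?case using \<alpha>[of "Suc k"] by (simp add: prev_def r_def min_def)
  qed
  have r0: "r 0 = t 0" using \<alpha>[of 0] by (simp add: prev_def fin)
  have rS: "r (Suc k) = min (t (Suc k)) (r k)" for k
  proof -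
    have "ereal (r (Suc k)) = ereal (min (t (Suc k)) (r k))"
      using \<alpha>[of "Suc k"] by (simp add: prev_def fin)
    then show ?thesis by (simp only: ereal.inject)
  qed
  show "r (Suc k) \<le> r k" by (simp add: rS)
  have t: "\<gamma> k / (1 + A) \<le> t k" for k
  proof (cases "G k (xh k) = 0")
    case True
    then show ?thesis using pos[of k] A by (simp add: t_def field_simps)
  next
    case False
    have "norm (G k (xh k) - G k (x k)) \<le> A * norm (G k (x k))"
      using crit by (auto simp: critical_condition_def)
    from critical_inner_lower[OF this A]
    have "\<gamma> k * ((norm (G k (xh k)))\<^sup>2 / (1 + A)) \<le> \<gamma> k * (G k (xh k) \<bullet> G k (x k))"
      using pos[of k] by (intro mult_left_mono) auto
    then show ?thesis using False A by (simp add: t_def diff field_simps)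
  qed
  show "\<gamma> k / (1 + A) \<le> r k"
  proof (induction k)
    case 0
    then show ?case using t[of 0] r0 by simp
  next
    case (Suc k)
    moreover have "\<gamma> (Suc k) / (1 + A) \<le> \<gamma> k / (1 + A)"
      using dec A by (intro divide_right_mono) auto
    ultimately show ?case using t[of "Suc k"] rS by simp
  qed
  have "r k \<le> t k" by (cases k) (auto simp: r0 rS)
  then have "r k * (norm (G k (xh k)))\<^sup>2 \<le> t k * (norm (G k (xh k)))\<^sup>2"
    by (intro mult_right_mono) auto
  also have "\<dots> = G k (xh k) \<bullet> (x k - xh k)" by (simp add: t_def)
  finally show "r k * (norm (G k (xh k)))\<^sup>2 \<le> G k (xh k) \<bullet> (x k - xh k)" .
qed

text \<open>Summation by parts: the weights \<open>1 / r\<^sub>k\<close> increase, and the last one bounds the whole sum.\<close>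

lemma weighted_telescope_le:
  fixes a r :: "nat \<Rightarrow> real"
  assumes pos: "\<And>k. r k > 0" and dec: "\<And>k. r (Suc k) \<le> r k" and a: "\<And>k. a k \<le> B"
  shows "(\<Sum>k=0..K. (a k - a (Suc k)) / r k) \<le> (B - a (Suc K)) / r K"
proof (induction K)
  case 0
  then show ?case using pos[of 0] a[of 0] by (simp add: divide_right_mono less_imp_le)
next
  case (Suc K)
  have "(B - a (Suc K)) / r K \<le> (B - a (Suc K)) / r (Suc K)"
    using pos dec a by (intro divide_left_mono) (auto simp: mult_pos_pos)
  moreover have "(a (Suc K) - a (Suc (Suc K))) / r (Suc K) + (B - a (Suc K)) / r (Suc K)
      = (B - a (Suc (Suc K))) / r (Suc K)"
    by (simp add: add_divide_distrib[symmetric])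
  ultimately show ?case using Suc by simp
qed

text \<open>The term \<open>\<alpha>\<^sub>k\<^sup>2 (norm h)\<^sup>2\<close> from expanding \<open>(norm (x\<^sub>k\<^sub>+\<^sub>1 - u))\<^sup>2\<close> is absorbed by
  \<open>2 \<alpha>\<^sub>k (h \<bullet> (x\<^sub>k - xh\<^sub>k))\<close>, since \<open>\<alpha>\<^sub>k\<close> is at most the Polyak step. The comparison point is arbitrary,
  so it may depend on the whole run.\<close>

lemma polyak_regret:
  fixes G :: "nat \<Rightarrow> 'v \<Rightarrow> 'v::real_inner"
  assumes A: "0 < A" "A < 1"
    and it: "polyak_seg_iterates G \<gamma> x0 x xh \<alpha>"
    and pos: "\<And>k. \<gamma> k > 0" and dec: "\<And>k. \<gamma> (Suc k) \<le> \<gamma> k"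
    and crit: "critical_condition A G x xh"
    and B: "\<And>k. norm (x k - u) \<le> B"
  shows "(\<Sum>k=0..K. G k (xh k) \<bullet> (xh k - u)) \<le> (1 + A) * B\<^sup>2 / (2 * \<gamma> K)"
proof -
  define r where "r k = real_of_ereal (\<alpha> k)" for k
  note R = polyak_step_size[OF A it pos dec crit, folded r_def]
  have rpos: "r k > 0" for k
    using R(2)[of k] pos[of k] A by (smt (verit) divide_pos_pos)
  define a where "a k = (norm (x k - u))\<^sup>2" for k
  have aB: "a k \<le> B\<^sup>2" for k unfolding a_def using B by (intro power_mono) auto
  have step: "G k (xh k) \<bullet> (xh k - u) \<le> (a k - a (Suc k)) / r k / 2" for k
  proof -
    let ?h = "G k (xh k)"
    have "x (Suc k) - u = (x k - u) - r k *\<^sub>R ?h"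
      using it by (simp add: polyak_seg_iterates_def r_def)
    moreover have "(norm (v - t *\<^sub>R w))\<^sup>2 = (norm v)\<^sup>2 - 2 * t * (w \<bullet> v) + t\<^sup>2 * (norm w)\<^sup>2"
      for v w :: 'v and t
      by (simp add: power2_norm_eq_inner inner_diff inner_commute algebra_simps)
         (simp add: power2_eq_square)
    ultimately have "a (Suc k) = a k - 2 * r k * (?h \<bullet> (x k - u)) + (r k)\<^sup>2 * (norm ?h)\<^sup>2"
      by (simp only: a_def)
    moreover have "?h \<bullet> (x k - u) = ?h \<bullet> (x k - xh k) + ?h \<bullet> (xh k - u)"
      by (simp add: inner_diff)
    moreover have "r k * (?h \<bullet> (x k - xh k)) \<ge> r k * (r k * (norm ?h)\<^sup>2)"
      using R(3)[of k] rpos[of k] by (intro mult_left_mono) auto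
    moreover have "(r k)\<^sup>2 * (norm ?h)\<^sup>2 \<ge> 0" by simp
    ultimately have "2 * r k * (?h \<bullet> (xh k - u)) \<le> a k - a (Suc k)"
      by (simp add: distrib_left power2_eq_square mult.assoc)
    then show ?thesis using rpos[of k] by (simp add: pos_le_divide_eq mult_ac)
  qed
  have "(\<Sum>k=0..K. G k (xh k) \<bullet> (xh k - u)) \<le> (\<Sum>k=0..K. (a k - a (Suc k)) / r k / 2)"
    by (intro sum_mono step)
  also have "\<dots> = (\<Sum>k=0..K. (a k - a (Suc k)) / r k) / 2"
    by (simp add: sum_divide_distrib)
  also have "\<dots> \<le> (B\<^sup>2 - a (Suc K)) / r K / 2"
    by (intro divide_right_mono weighted_telescope_le rpos R(1) aB) simp
  also have "\<dots> \<le> B\<^sup>2 / r K / 2"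
    using rpos[of K] by (simp add: divide_right_mono a_def)
  also have "\<dots> \<le> B\<^sup>2 / (\<gamma> K / (1 + A)) / 2"
    using R(2)[of K] A pos[of K] rpos[of K]
    by (intro divide_right_mono divide_left_mono) auto
  finally show ?thesis by (simp add: algebra_simps)
qed

section \<open>From regret to the operator norm\<close>

text \<open>With \<open>u = z - G z / (2 L)\<close> the vector \<open>G u\<close> stays within \<open>norm (G z) / 2\<close> of \<open>G z\<close>.\<close>

lemma operator_norm_le_gap:
  fixes G :: "'v \<Rightarrow> 'v::real_inner" and z :: 'v
  assumes lip: "\<And>y z. norm (G y - G z) \<le> L * norm (y - z)" and L: "L > 0"
  defines "u \<equiv> z - (1 / (2 * L)) *\<^sub>R G z"
  shows "(norm (G z))\<^sup>2 \<le> 4 * L * (G u \<bullet> (z - u))"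
proof -
  have zu: "z - u = (1 / (2 * L)) *\<^sub>R G z" by (simp add: u_def)
  have "norm (G z - G u) \<le> L * norm (z - u)" by (rule lip)
  also have "\<dots> = norm (G z) / 2" using L by (simp add: zu)
  finally have 1: "norm (G z - G u) \<le> norm (G z) / 2" .
  have "(G z - G u) \<bullet> G z \<le> norm (G z - G u) * norm (G z)" by (rule norm_cauchy_schwarz)
  also have "\<dots> \<le> norm (G z) / 2 * norm (G z)" using 1 by (intro mult_right_mono) auto
  finally have "(norm (G z))\<^sup>2 \<le> 2 * (G u \<bullet> G z)"
    by (simp add: inner_diff power2_norm_eq_inner norm_eq_sqrt_inner)
  also have "\<dots> = 4 * L * (G u \<bullet> (z - u))" using L by (simp add: zu)
  finally show ?thesis .
qed

lemma monotone_gap_average: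
  fixes G :: "'v \<Rightarrow> 'v::real_inner" and y :: "nat \<Rightarrow> 'v"
  assumes "monotone_operator G"
  shows "real (K + 1) * (G u \<bullet> ((1 / real (K + 1)) *\<^sub>R (\<Sum>k=0..K. y k) - u))
    \<le> (\<Sum>k=0..K. G (y k) \<bullet> (y k - u))"
proof -
  have "real (K + 1) * (G u \<bullet> ((1 / real (K + 1)) *\<^sub>R (\<Sum>k=0..K. y k) - u))
      = G u \<bullet> ((\<Sum>k=0..K. y k) - real (K + 1) *\<^sub>R u)"
    by (simp add: inner_diff_right right_diff_distrib)
  also have "(\<Sum>k=0..K. y k) - real (K + 1) *\<^sub>R u = (\<Sum>k=0..K. y k - u)"
    by (simp add: sum_subtractf sum_constant_scaleR del: sum_constant)
  also have "G u \<bullet> \<dots> = (\<Sum>k=0..K. G u \<bullet> (y k - u))" by (simp add: inner_sum_right)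
  also have "\<dots> \<le> (\<Sum>k=0..K. G (y k) \<bullet> (y k - u))"
  proof (intro sum_mono)
    fix k
    have "(G (y k) - G u) \<bullet> (y k - u) \<ge> 0" using assms by (simp add: monotone_operator_def)
    then show "G u \<bullet> (y k - u) \<le> G (y k) \<bullet> (y k - u)" by (simp add: inner_diff_left)
  qed
  finally show ?thesis .
qed

text \<open>The four terms are the regret, the noise against the anchor \<open>x0\<close>, the drift of the accumulated
  noise, and the error of evaluating the batch at the extrapolated point. The comparison point, which
  depends on the future of the run, has been eliminated from all of them.\<close>

lemma residual_pathwise_bound:
  fixes G :: "nat \<Rightarrow> 'v \<Rightarrow> 'v::real_inner"
  assumes A: "0 < A" "A < 1" and L: "L > 0" and \<gamma>low: "\<gamma>low > 0"
    and lipF: "\<And>y z. norm (F y - F z) \<le> L * norm (y - z)"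
    and lipG: "\<And>k y z. norm (G k y - G k z) \<le> L * norm (y - z)"
    and mono: "monotone_operator F"
    and it: "polyak_seg_iterates G \<gamma> x0 x xh \<alpha>"
    and pos: "\<And>k. \<gamma> k > 0" and dec: "\<And>k. \<gamma> (Suc k) \<le> \<gamma> k"
    and upper: "\<And>k. \<gamma> k \<le> \<gamma>m1 / sqrt (real k + 1)"
    and lower: "\<And>k. \<gamma> k \<ge> \<gamma>low / sqrt (real k + 1)"
    and crit: "critical_condition A G x xh"
    and C: "convex C" "\<And>y z. y \<in> C \<Longrightarrow> z \<in> C \<Longrightarrow> norm (y - z) \<le> D"
    and inC: "\<And>k. x k \<in> C" "\<And>k. xh k \<in> C"
    and xstar: "xstar \<in> C" "F xstar = 0"
  defines "e \<equiv> \<lambda>k. F (x k) - G k (x k)"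
  shows "(norm (F ((1 / real (K + 1)) *\<^sub>R (\<Sum>k=0..K. xh k))))\<^sup>2 \<le> 4 * L / real (K + 1) *
    (9 * (1 + A) * D\<^sup>2 / (8 * \<gamma>low) * sqrt (real K + 1)
     + (\<Sum>k=0..K. e k \<bullet> (x k - x0)) + 3 * D / 2 * norm (\<Sum>k=0..K. e k)
     + (\<Sum>k=0..K. \<gamma>m1 / sqrt (real k + 1) *
         (3 * L * D * norm (G k (x k)) + norm (e k) * norm (G k (x k)))))"
proof -
  define z where "z = (1 / real (K + 1)) *\<^sub>R (\<Sum>k=0..K. xh k)"
  define u where "u = z - (1 / (2 * L)) *\<^sub>R F z"
  have D: "D \<ge> 0" using C(2)[OF xstar(1) xstar(1)] by simp
  have x0: "x0 = x 0" and diff: "x k - xh k = \<gamma> k *\<^sub>R G k (x k)" for k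
    using it by (auto simp: polyak_seg_iterates_def)
  have "z \<in> C"
    unfolding z_def scaleR_sum_right
    by (rule convex_sum) (use C(1) inC in \<open>auto simp: field_simps\<close>)
  then have "norm (F z) \<le> L * D"
    using lipF[of z xstar] C(2)[of z xstar] xstar L by (smt (verit) diff_zero mult_left_mono)
  then have "norm (z - u) \<le> D / 2" using L by (simp add: u_def field_simps)
  then have close: "norm (y - u) \<le> 3 / 2 * D" if "y \<in> C" for y
    using C(2)[OF that \<open>z \<in> C\<close>] norm_triangle_ineq[of "y - z" "z - u"] by simp
  have regret: "(\<Sum>k=0..K. G k (xh k) \<bullet> (xh k - u)) \<le> 9 * (1 + A) * D\<^sup>2 / (8 * \<gamma>low) * sqrt (real K + 1)"
  proof -
    have "(\<Sum>k=0..K. G k (xh k) \<bullet> (xh k - u)) \<le> (1 + A) * (3 / 2 * D)\<^sup>2 / (2 * \<gamma> K)"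
      by (rule polyak_regret[OF A it pos dec crit close[OF inC(1)]])
    also have "\<dots> \<le> (1 + A) * (3 / 2 * D)\<^sup>2 / (2 * (\<gamma>low / sqrt (real K + 1)))"
      using lower[of K] pos[of K] \<gamma>low A by (intro divide_left_mono) auto
    also have "\<dots> = 9 * (1 + A) * D\<^sup>2 / (8 * \<gamma>low) * sqrt (real K + 1)"
      using \<gamma>low by (simp add: power_mult_distrib power_divide field_simps)
    finally show ?thesis .
  qed
  have step: "F (xh k) \<bullet> (xh k - u) \<le> G k (xh k) \<bullet> (xh k - u) + e k \<bullet> (x k - x0) + e k \<bullet> (x0 - u)
      + \<gamma>m1 / sqrt (real k + 1) * (3 * L * D * norm (G k (x k)) + norm (e k) * norm (G k (x k)))" for k
  proof -
    let ?g = "G k (x k)"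
    let ?d = "(F (xh k) - F (x k)) - (G k (xh k) - G k (x k))"
    have xx: "norm (xh k - x k) = \<gamma> k * norm ?g"
      using diff[of k] pos[of k] by (metis abs_of_pos norm_minus_commute norm_scaleR)
    have "norm ?d \<le> L * norm (xh k - x k) + L * norm (xh k - x k)"
      by (rule order_trans[OF norm_triangle_ineq4 add_mono[OF lipF lipG]])
    then have d: "norm ?d \<le> 2 * L * (\<gamma> k * norm ?g)" by (simp add: xx)
    have "?d \<bullet> (xh k - u) \<le> norm ?d * norm (xh k - u)" by (rule norm_cauchy_schwarz)
    also have "\<dots> \<le> (2 * L * (\<gamma> k * norm ?g)) * (3 / 2 * D)"
      by (rule mult_mono[OF d close[OF inC(2)]]) (use L pos[of k] in auto)
    finally have 1: "?d \<bullet> (xh k - u) \<le> \<gamma> k * (3 * L * D * norm ?g)" by (simp add: algebra_simps)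
    have "- (e k \<bullet> ?g) \<le> norm (e k) * norm ?g"
      using norm_cauchy_schwarz[of "- e k" ?g] by simp
    then have 2: "- (\<gamma> k * (e k \<bullet> ?g)) \<le> \<gamma> k * (norm (e k) * norm ?g)"
      using pos[of k] by (metis less_imp_le mult_left_mono mult_minus_right)
    have 3: "\<gamma> k * (3 * L * D * norm ?g + norm (e k) * norm ?g)
        \<le> \<gamma>m1 / sqrt (real k + 1) * (3 * L * D * norm ?g + norm (e k) * norm ?g)"
      using upper[of k] L D by (intro mult_right_mono) auto
    \<comment> \<open>The noise is taken at \<open>x k\<close>, where the batch is fresh; moving to \<open>xh k\<close> costs Lipschitz terms.\<close>
    have "F (xh k) = G k (xh k) + ?d + e k" by (simp add: e_def)
    then have "F (xh k) \<bullet> (xh k - u) = G k (xh k) \<bullet> (xh k - u) + ?d \<bullet> (xh k - u) + e k \<bullet> (xh k - u)"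
      by (metis inner_add_left)
    moreover have "xh k - u = (x k - x0) + (x0 - u) - \<gamma> k *\<^sub>R ?g"
      using diff[of k] by (simp add: algebra_simps)
    then have "e k \<bullet> (xh k - u) = e k \<bullet> (x k - x0) + e k \<bullet> (x0 - u) - \<gamma> k * (e k \<bullet> ?g)"
      by (metis inner_add_right inner_diff_right inner_scaleR_right)
    ultimately show ?thesis using 1 2 3 by (simp add: distrib_left)
  qed
  have "(\<Sum>k=0..K. e k \<bullet> (x0 - u)) = (\<Sum>k=0..K. e k) \<bullet> (x0 - u)"
    by (simp add: inner_sum_left)
  also have "\<dots> \<le> norm (\<Sum>k=0..K. e k) * norm (x0 - u)" by (rule norm_cauchy_schwarz)
  also have "\<dots> \<le> norm (\<Sum>k=0..K. e k) * (3 / 2 * D)"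
    using close[OF inC(1)[of 0]] x0 by (intro mult_left_mono) auto
  finally have anchor: "(\<Sum>k=0..K. e k \<bullet> (x0 - u)) \<le> 3 * D / 2 * norm (\<Sum>k=0..K. e k)"
    by (simp add: mult_ac)
  have "real (K + 1) * (F u \<bullet> (z - u)) \<le> (\<Sum>k=0..K. F (xh k) \<bullet> (xh k - u))"
    unfolding z_def by (rule monotone_gap_average[OF mono])
  also have "\<dots> \<le> (\<Sum>k=0..K. G k (xh k) \<bullet> (xh k - u) + e k \<bullet> (x k - x0) + e k \<bullet> (x0 - u)
      + \<gamma>m1 / sqrt (real k + 1) * (3 * L * D * norm (G k (x k)) + norm (e k) * norm (G k (x k))))"
    by (intro sum_mono step)
  also have "\<dots> \<le> 9 * (1 + A) * D\<^sup>2 / (8 * \<gamma>low) * sqrt (real K + 1)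
     + (\<Sum>k=0..K. e k \<bullet> (x k - x0)) + 3 * D / 2 * norm (\<Sum>k=0..K. e k)
     + (\<Sum>k=0..K. \<gamma>m1 / sqrt (real k + 1) *
         (3 * L * D * norm (G k (x k)) + norm (e k) * norm (G k (x k))))" (is "_ \<le> ?R")
    unfolding sum.distrib by (intro add_mono regret anchor order_refl)
  finally have "F u \<bullet> (z - u) \<le> ?R / real (K + 1)" by (simp add: field_simps)
  then have "4 * L * (F u \<bullet> (z - u)) \<le> 4 * L * (?R / real (K + 1))"
    using L by (intro mult_left_mono) auto
  moreover have "(norm (F z))\<^sup>2 \<le> 4 * L * (F u \<bullet> (z - u))"
    unfolding u_def by (rule operator_norm_le_gap[OF lipF L])
  ultimately show ?thesis unfolding z_def by simp
qed

lemma sum_inverse_sqrt_le: "(\<Sum>k=0..K. 1 / sqrt (real k + 1)) \<le> 2 * sqrt (real K + 1)"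
proof (induction K)
  case (Suc K)
  define p q where "p = sqrt (real K + 1)" and "q = sqrt (real (Suc K) + 1)"
  have q: "q > 0" "q\<^sup>2 = p\<^sup>2 + 1" by (auto simp: p_def q_def)
  have "0 \<le> (q - p)\<^sup>2" by simp
  then have "1 + 2 * p * q \<le> 2 * q\<^sup>2" using q by (simp add: power2_diff algebra_simps)
  then have "1 / q + 2 * p \<le> 2 * q" using q(1) by (simp add: field_simps power2_eq_square)
  with Suc show ?case by (simp add: p_def q_def)
qed simp

section \<open>Sampling noise\<close>

locale sampled_operators = prob_space M for M :: "'w measure" +
  fixes Fi :: "nat \<Rightarrow> 'v \<Rightarrow> 'v::euclidean_space" and F :: "'v \<Rightarrow> 'v"
    and \<F> :: "nat \<Rightarrow> 'w measure" and S :: "nat \<Rightarrow> 'w \<Rightarrow> nat list"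
    and n b :: nat and L :: real
  assumes n: "n \<ge> 1" and b: "b \<ge> 1" and L: "L > 0"
    and lipschitz: "\<And>i. i \<in> {1..n} \<Longrightarrow> L-lipschitz_on UNIV (Fi i)"
    and F: "\<And>y. F y = (1 / real n) *\<^sub>R (\<Sum>i=1..n. Fi i y)"
    and sampling: "batch_sampling M \<F> n b S"
begin

lemma subalg: "subalgebra M (\<F> k)"
  and S_meas: "S k \<in> \<F> (Suc k) \<rightarrow>\<^sub>M count_space (batches n b)"
  and S_distr: "distr M (count_space (batches n b)) (S k) = uniform_count_measure (batches n b)"
  and S_indep: "indep_set (sets (\<F> k)) {S k -` B \<inter> space M | B. B \<subseteq> batches n b}"
  and filtr: "filtration (space M) \<F>"
  using sampling unfolding batch_sampling_def by blast+

lemma space_\<F>: "space (\<F> k) = space M"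
  using subalg by (simp add: subalgebra_def)

lemma S_in: "\<omega> \<in> space M \<Longrightarrow> S k \<omega> \<in> batches n b"
  using measurable_space[OF S_meas, of \<omega> k] by (simp add: space_\<F>)

lemma meas_M: "f \<in> borel_measurable (\<F> k) \<Longrightarrow> f \<in> borel_measurable M"
  by (rule measurable_from_subalg[OF subalg])

lemma meas_later: "f \<in> borel_measurable (\<F> j) \<Longrightarrow> j \<le> k \<Longrightarrow> f \<in> borel_measurable (\<F> k)"
  by (rule measurable_from_subalg[of "\<F> k" "\<F> j"])
     (use filtr in \<open>auto simp: subalgebra_def space_\<F> filtration.sets_F_mono\<close>)

lemma batch_lip: "s \<in> batches n b \<Longrightarrow> norm (batch_op Fi s y - batch_op Fi s z) \<le> L * norm (y - z)"
  by (rule batch_op_lipschitz[OF lipschitz _ b])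

lemma F_lip: "norm (F y - F z) \<le> L * norm (y - z)"
proof -
  \<comment> \<open>\<open>F\<close> is itself a batch operator, for the batch that contains each index once.\<close>
  have "(\<Sum>i=1..n. Fi i w) = (\<Sum>i\<leftarrow>[1..<Suc n]. Fi i w)" for w
    by (subst sum_list_distinct_conv_sum_set) (auto intro!: sum.cong)
  then have "F w = batch_op Fi [1..<Suc n] w" for w
    by (simp add: F batch_op_def del: upt_Suc)
  moreover have "norm (batch_op Fi [1..<Suc n] y - batch_op Fi [1..<Suc n] z) \<le> L * norm (y - z)"
    by (rule batch_op_lipschitz[OF lipschitz _ n]) (auto simp: batches_def)
  ultimately show ?thesis by simp
qed

lemma continuous_lip:
  assumes "\<And>y z. norm (H y - H z) \<le> L * norm (y - z)"
  shows "continuous_on UNIV (H :: 'v \<Rightarrow> 'v)"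
proof -
  have "L-lipschitz_on UNIV H" using assms L by (auto simp: lipschitz_on_def dist_norm)
  then show ?thesis by (rule lipschitz_on_continuous_on)
qed

lemma batch_meas: "s \<in> batches n b \<Longrightarrow> batch_op Fi s \<in> borel_measurable borel"
  by (intro borel_measurable_continuous_onI continuous_lip batch_lip)

lemma F_meas: "F \<in> borel_measurable borel"
  by (intro borel_measurable_continuous_onI continuous_lip F_lip)

lemma sampled_meas:
  assumes "X \<in> borel_measurable (\<F> (Suc k))"
  shows "(\<lambda>\<omega>. batch_op Fi (S k \<omega>) (X \<omega>)) \<in> borel_measurable (\<F> (Suc k))"
proof (rule measurable_compose_countable'[OF _ S_meas])
  fix s assume "s \<in> batches n b"
  then show "(\<lambda>\<omega>. batch_op Fi s (X \<omega>)) \<in> borel_measurable (\<F> (Suc k))"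
    using measurable_compose[OF assms batch_meas] by simp
qed (simp add: countable_finite)

lemma card_pos: "real (n ^ b) > 0" using n by simp

lemma batch_mean: "(\<Sum>s\<in>batches n b. batch_op Fi s y) = real (n ^ b) *\<^sub>R F y"
  unfolding F batch_op_unbiased[OF n b, symmetric] using n by simp

text \<open>The event that batch \<open>s\<close> is drawn in step \<open>k\<close> has probability \<open>1 / n\<^sup>b\<close> and is independent of
  everything known before.\<close>

lemma fresh_indicator:
  fixes Y :: "'w \<Rightarrow> real"
  assumes s: "s \<in> batches n b" and Y: "Y \<in> borel_measurable (\<F> k)" "integrable M Y"
  shows "integrable M (\<lambda>\<omega>. indicator {s} (S k \<omega>) * Y \<omega>)" (is ?I)
    and "expectation (\<lambda>\<omega>. indicator {s} (S k \<omega>) * Y \<omega>) = expectation Y / real (n ^ b)" (is ?E)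
proof -
  let ?J = "\<lambda>\<omega>. indicator {s} (S k \<omega>) :: real"
  have SM: "S k \<in> M \<rightarrow>\<^sub>M count_space (batches n b)"
    by (rule measurable_from_subalg[OF subalg S_meas])
  have J: "?J \<in> borel_measurable M"
    using measurable_compose[OF SM, of "indicator {s}" borel] by simp
  have stable: "Int_stable {f -` B \<inter> space M | B. B \<in> sets borel}" for f :: "'w \<Rightarrow> real"
  proof (rule Int_stableI, clarsimp)
    fix B B' :: "real set" assume "B \<in> sets borel" "B' \<in> sets borel"
    then show "\<exists>B''. f -` B \<inter> space M \<inter> (f -` B' \<inter> space M) = f -` B'' \<inter> space M \<and> B'' \<in> sets borel"
      by (intro exI[of _ "B \<inter> B'"]) auto
  qed
  have "{Y -` B \<inter> space M | B. B \<in> sets borel} \<subseteq> sets (\<F> k)"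
    using measurable_sets[OF Y(1)] by (auto simp: space_\<F>)
  moreover have "{?J -` B \<inter> space M | B. B \<in> sets borel} \<subseteq> {S k -` B \<inter> space M | B. B \<subseteq> batches n b}"
  proof clarify
    fix B :: "real set"
    show "\<exists>B'. ?J -` B \<inter> space M = S k -` B' \<inter> space M \<and> B' \<subseteq> batches n b"
      using S_in[of _ k] by (intro exI[of _ "{t \<in> batches n b. indicator {s} t \<in> B}"]) auto
  qed
  ultimately have "indep_set {Y -` B \<inter> space M | B. B \<in> sets borel} {?J -` B \<inter> space M | B. B \<in> sets borel}"
    using S_indep[of k] unfolding indep_sets2_eq by (meson subset_iff)
  from indep_set_sigma_sets[OF this stable stable]
  have indep: "indep_var borel Y borel ?J"
    unfolding indep_var_eq using meas_M[OF Y(1)] J by simp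
  have int: "integrable M (\<lambda>\<omega>. indicator {s} (S k \<omega>) :: real)"
    by (rule integrable_const_bound[where B=1])
       (use J in \<open>auto simp: indicator_def\<close>)
  show ?I
    using indep_var_integrable[OF indep Y(2) int] by (simp add: mult.commute)
  have "expectation (\<lambda>\<omega>. indicator {s} (S k \<omega>) :: real)
      = (\<integral>t. indicator {s} t \<partial>distr M (count_space (batches n b)) (S k))"
    by (rule integral_distr[symmetric, OF SM]) simp
  also have "\<dots> = (\<Sum>t\<in>batches n b. indicator {s} t) / real (n ^ b)"
    unfolding S_distr integral_uniform_count_measure[OF finite_batches] card_batches ..
  also have "\<dots> = 1 / real (n ^ b)"
    using s by (simp add: indicator_def sum.delta)
  finally show ?E
    using indep_var_lebesgue_integral[OF indep Y(2) int] by (simp add: mult.commute)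
qed

text \<open>Conditioning on the past replaces the fresh batch by the average over all batches. As there are
  only finitely many, splitting by the drawn batch makes this elementary.\<close>

lemma fresh_sample:
  fixes \<phi> :: "nat list \<Rightarrow> 'w \<Rightarrow> real"
  assumes "\<And>s. s \<in> batches n b \<Longrightarrow> \<phi> s \<in> borel_measurable (\<F> k)"
    and "\<And>s. s \<in> batches n b \<Longrightarrow> integrable M (\<phi> s)"
  shows "integrable M (\<lambda>\<omega>. \<phi> (S k \<omega>) \<omega>)" (is ?I)
    and "expectation (\<lambda>\<omega>. \<phi> (S k \<omega>) \<omega>) = expectation (\<lambda>\<omega>. (\<Sum>s\<in>batches n b. \<phi> s \<omega>) / real (n ^ b))"
      (is ?E)
proof -
  have split: "\<phi> (S k \<omega>) \<omega> = (\<Sum>s\<in>batches n b. indicator {s} (S k \<omega>) * \<phi> s \<omega>)"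
    if "\<omega> \<in> space M" for \<omega>
    using S_in[OF that, of k] by (simp add: indicator_def sum.delta' if_distrib[of "\<lambda>t. t * _"] cong: if_cong)
  note ind = fresh_indicator[OF _ assms]
  have int: "integrable M (\<lambda>\<omega>. \<Sum>s\<in>batches n b. indicator {s} (S k \<omega>) * \<phi> s \<omega>)"
    by (intro Bochner_Integration.integrable_sum ind(1))
  show ?I
    by (rule iffD2[OF Bochner_Integration.integrable_cong[OF refl split] int])
  have "expectation (\<lambda>\<omega>. \<phi> (S k \<omega>) \<omega>) = expectation (\<lambda>\<omega>. \<Sum>s\<in>batches n b. indicator {s} (S k \<omega>) * \<phi> s \<omega>)"
    by (rule Bochner_Integration.integral_cong[OF refl split])
  also have "\<dots> = (\<Sum>s\<in>batches n b. expectation (\<lambda>\<omega>. indicator {s} (S k \<omega>) * \<phi> s \<omega>))"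
    by (intro Bochner_Integration.integral_sum ind(1))
  also have "\<dots> = (\<Sum>s\<in>batches n b. expectation (\<phi> s) / real (n ^ b))"
    by (intro sum.cong refl ind(2))
  also have "\<dots> = expectation (\<lambda>\<omega>. (\<Sum>s\<in>batches n b. \<phi> s \<omega>) / real (n ^ b))"
    using assms(2) by (simp add: sum_divide_distrib)
  finally show ?E .
qed

text \<open>A variance is at most the second moment; \<open>F y\<close> is the mean of the batch operators at \<open>y\<close>.\<close>

lemma batch_variance_le:
  "(\<Sum>s\<in>batches n b. (norm (F y - batch_op Fi s y))\<^sup>2) \<le> (\<Sum>s\<in>batches n b. (norm (batch_op Fi s y))\<^sup>2)"
proof -
  have "(\<Sum>s\<in>batches n b. (norm (F y - batch_op Fi s y))\<^sup>2)
      = (\<Sum>s\<in>batches n b. (norm (F y))\<^sup>2 - 2 * (F y \<bullet> batch_op Fi s y) + (norm (batch_op Fi s y))\<^sup>2)"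
    by (intro sum.cong refl) (simp add: power2_norm_eq_inner inner_diff inner_commute)
  also have "\<dots> = real (n ^ b) * (norm (F y))\<^sup>2 - 2 * (F y \<bullet> (\<Sum>s\<in>batches n b. batch_op Fi s y))
      + (\<Sum>s\<in>batches n b. (norm (batch_op Fi s y))\<^sup>2)"
    by (simp add: sum.distrib sum_subtractf sum_distrib_left[symmetric] inner_sum_right card_batches)
  also have "\<dots> = (\<Sum>s\<in>batches n b. (norm (batch_op Fi s y))\<^sup>2) - real (n ^ b) * (norm (F y))\<^sup>2"
    by (simp add: batch_mean power2_norm_eq_inner)
  finally show ?thesis by simp
qed

end

locale bounded_noise = sampled_operators M Fi F \<F> S n b L
  for M :: "'w measure" and Fi :: "nat \<Rightarrow> 'v \<Rightarrow> 'v::euclidean_space" and F \<F> S n b L +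
  fixes xstar :: 'v and D \<sigma> :: real
  assumes D: "D \<ge> 0"
    and \<sigma>0: "\<sigma> \<ge> 0"
    and \<sigma>: "\<sigma>\<^sup>2 = 2 * L\<^sup>2 * D\<^sup>2
      + 2 * (\<integral>s. (norm (batch_op Fi s xstar))\<^sup>2 \<partial>uniform_count_measure (batches n b))"
begin

lemma batch_sum_\<sigma>:
  "2 * (\<Sum>s\<in>batches n b. (norm (batch_op Fi s xstar))\<^sup>2) + real (n ^ b) * (2 * (L * D)\<^sup>2) = real (n ^ b) * \<sigma>\<^sup>2"
proof -
  have "2 * T + N * (2 * (L * D)\<^sup>2) = N * (2 * L\<^sup>2 * D\<^sup>2 + 2 * (T / N))" if "N > 0" for T N :: real
    using that by (simp add: power_mult_distrib field_simps)
  from this[OF card_pos] show ?thesis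
    unfolding \<sigma> integral_uniform_count_measure[OF finite_batches] card_batches .
qed

lemma batch_norm_le:
  assumes "s \<in> batches n b" "norm (y - xstar) \<le> D"
  shows "norm (batch_op Fi s y) \<le> norm (batch_op Fi s xstar) + L * D"
proof -
  have "norm (batch_op Fi s y - batch_op Fi s xstar) \<le> L * D"
    using batch_lip[OF assms(1), of y xstar] assms(2) L by (smt (verit) mult_left_mono)
  then show ?thesis
    using norm_triangle_ineq[of "batch_op Fi s y - batch_op Fi s xstar" "batch_op Fi s xstar"] by simp
qed

text \<open>A crude bound, uniform over batches and over the ball of radius \<open>D\<close> around \<open>xstar\<close>. It serves
  to make the random variables below integrable.\<close>

definition batch_bound :: real where
  "batch_bound = (\<Sum>s\<in>batches n b. norm (batch_op Fi s xstar)) + L * D"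

lemma batch_norm_bound:
  assumes "s \<in> batches n b" "norm (y - xstar) \<le> D"
  shows "norm (batch_op Fi s y) \<le> batch_bound"
proof -
  have "norm (batch_op Fi s xstar) \<le> (\<Sum>s\<in>batches n b. norm (batch_op Fi s xstar))"
    by (rule member_le_sum[OF assms(1)]) auto
  then show ?thesis using batch_norm_le[OF assms] by (simp add: batch_bound_def)
qed

lemma batch_bound_nonneg: "batch_bound \<ge> 0"
  using D L by (simp add: batch_bound_def sum_nonneg)

lemma noise_norm_bound:
  assumes "s \<in> batches n b" "norm (y - xstar) \<le> D"
  shows "norm (F y - batch_op Fi s y) \<le> 2 * batch_bound"
proof -
  have "real (n ^ b) * norm (F y) = norm (\<Sum>s\<in>batches n b. batch_op Fi s y)"
    by (simp add: batch_mean)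
  also have "\<dots> \<le> (\<Sum>s\<in>batches n b. batch_bound)"
    by (intro sum_norm_le batch_norm_bound assms(2))
  finally have "norm (F y) \<le> batch_bound"
    using card_pos by (simp add: card_batches)
  then show ?thesis
    using batch_norm_bound[OF assms] norm_triangle_ineq4[of "F y" "batch_op Fi s y"] by simp
qed

text \<open>The reason for the value of \<open>\<sigma>\<close> is \<open>(p + L D)\<^sup>2 \<le> 2 p\<^sup>2 + 2 L\<^sup>2 D\<^sup>2\<close> with \<open>p\<close> the norm of the batch operator at
  \<open>xstar\<close>.\<close>

lemma batch_second_moment:
  assumes "norm (y - xstar) \<le> D"
  shows "(\<Sum>s\<in>batches n b. (norm (F y - batch_op Fi s y))\<^sup>2) \<le> real (n ^ b) * \<sigma>\<^sup>2"
proof -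
  have "(\<Sum>s\<in>batches n b. (norm (batch_op Fi s y))\<^sup>2)
      \<le> (\<Sum>s\<in>batches n b. 2 * (norm (batch_op Fi s xstar))\<^sup>2 + 2 * (L * D)\<^sup>2)"
  proof (intro sum_mono)
    fix s assume s: "s \<in> batches n b"
    let ?p = "norm (batch_op Fi s xstar)"
    have "(norm (batch_op Fi s y))\<^sup>2 \<le> (?p + L * D)\<^sup>2"
      by (intro power_mono batch_norm_le[OF s assms]) simp
    moreover have "0 \<le> (?p - L * D)\<^sup>2" by simp
    ultimately show "(norm (batch_op Fi s y))\<^sup>2 \<le> 2 * ?p\<^sup>2 + 2 * (L * D)\<^sup>2"
      unfolding power2_sum power2_diff by linarith
  qed
  also have "\<dots> = real (n ^ b) * \<sigma>\<^sup>2"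
    unfolding batch_sum_\<sigma>[symmetric] by (simp add: sum.distrib sum_distrib_left card_batches)
  finally show ?thesis using batch_variance_le[of y] by linarith
qed

text \<open>The product of the two norms is at most the mean of their squares, and after summation the
  variance bound replaces the noise by the batch operator \<open>g\<close> at \<open>y\<close>. With \<open>l = L D\<close> and \<open>p\<close> the norm of the batch operator
  at \<open>xstar\<close>, the bound \<open>norm g \<le> p + l\<close> leaves the polynomial inequality
  \<open>p\<^sup>2 + 5 p l + 4 l\<^sup>2 \<le> 2 p\<^sup>2 + 11 l\<^sup>2\<close>, which holds since \<open>5\<^sup>2 < 4 \<cdot> 7\<close>. Estimating the second moment of \<open>g\<close>
  by \<open>\<sigma>\<^sup>2\<close> first would lose too much here when \<open>\<sigma>\<close> is large compared with \<open>l\<close>.\<close>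

lemma batch_extrapolation_error:
  assumes y: "norm (y - xstar) \<le> D"
  shows "(\<Sum>s\<in>batches n b. 3 * L * D * norm (batch_op Fi s y)
      + norm (F y - batch_op Fi s y) * norm (batch_op Fi s y)) \<le> real (n ^ b) * (\<sigma>\<^sup>2 + 9 * L\<^sup>2 * D\<^sup>2)"
proof -
  let ?g = "\<lambda>s. norm (batch_op Fi s y)" and ?e = "\<lambda>s. norm (F y - batch_op Fi s y)"
    and ?p = "\<lambda>s. norm (batch_op Fi s xstar)"
  have "(\<Sum>s\<in>batches n b. 3 * L * D * ?g s + ?e s * ?g s)
      \<le> (\<Sum>s\<in>batches n b. 3 * (L * D) * ?g s + (?e s)\<^sup>2 / 2 + (?g s)\<^sup>2 / 2)"
  proof (intro sum_mono)
    fix s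
    have "0 \<le> (?e s - ?g s)\<^sup>2" by simp
    then show "3 * L * D * ?g s + ?e s * ?g s \<le> 3 * (L * D) * ?g s + (?e s)\<^sup>2 / 2 + (?g s)\<^sup>2 / 2"
      unfolding power2_diff by simp
  qed
  also have "\<dots> \<le> (\<Sum>s\<in>batches n b. 3 * (L * D) * ?g s + (?g s)\<^sup>2)"
    using batch_variance_le[of y] by (simp add: sum.distrib sum_divide_distrib[symmetric])
  also have "\<dots> \<le> (\<Sum>s\<in>batches n b. 2 * (?p s)\<^sup>2 + 11 * (L * D)\<^sup>2)"
  proof (intro sum_mono)
    fix s assume s: "s \<in> batches n b"
    define p l where "p = ?p s" and "l = L * D"
    have g: "?g s \<le> p + l" unfolding p_def l_def by (rule batch_norm_le[OF s y])
    have "l \<ge> 0" using L D by (simp add: l_def)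
    then have "3 * l * ?g s + (?g s)\<^sup>2 \<le> 3 * l * (p + l) + (p + l)\<^sup>2"
      using g by (intro add_mono mult_left_mono power_mono) auto
    also have "\<dots> \<le> 2 * p\<^sup>2 + 11 * l\<^sup>2"
    proof -
      have "0 \<le> (p - 5 / 2 * l)\<^sup>2 + 3 / 4 * l\<^sup>2" by simp
      then show ?thesis by (simp add: power2_eq_square algebra_simps)
    qed
    finally show "3 * (L * D) * ?g s + (?g s)\<^sup>2 \<le> 2 * (?p s)\<^sup>2 + 11 * (L * D)\<^sup>2"
      by (simp add: p_def l_def)
  qed
  also have "\<dots> = 2 * (\<Sum>s\<in>batches n b. (?p s)\<^sup>2) + real (n ^ b) * (2 * (L * D)\<^sup>2)
      + real (n ^ b) * (9 * L\<^sup>2 * D\<^sup>2)"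
    by (simp add: sum.distrib sum_distrib_left card_batches power_mult_distrib)
  finally show ?thesis unfolding batch_sum_\<sigma> by (simp add: distrib_left)
qed

context
  fixes X :: "'w \<Rightarrow> 'v" and k :: nat
  assumes X: "X \<in> borel_measurable (\<F> k)" and near: "AE \<omega> in M. norm (X \<omega> - xstar) \<le> D"
begin

lemma F_X_meas: "(\<lambda>\<omega>. F (X \<omega>)) \<in> borel_measurable (\<F> k)"
  by (rule measurable_compose[OF X F_meas])

lemma batch_X_meas: "s \<in> batches n b \<Longrightarrow> (\<lambda>\<omega>. batch_op Fi s (X \<omega>)) \<in> borel_measurable (\<F> k)"
  by (rule measurable_compose[OF X batch_meas])

lemma noise_bound_AE:
  "AE \<omega> in M. norm (F (X \<omega>) - batch_op Fi (S k \<omega>) (X \<omega>)) \<le> 2 * batch_bound"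
  using near AE_space by eventually_elim (rule noise_norm_bound[OF S_in])

lemma noise_meas:
  "(\<lambda>\<omega>. F (X \<omega>) - batch_op Fi (S k \<omega>) (X \<omega>)) \<in> borel_measurable (\<F> (Suc k))"
proof -
  have "X \<in> borel_measurable (\<F> (Suc k))" by (rule meas_later[OF X]) simp
  then show ?thesis
    using sampled_meas measurable_compose[OF _ F_meas] by (intro borel_measurable_diff) auto
qed

text \<open>For every possible past the noise averages to zero over the batches, while \<open>V\<close> is the same for
  all of them.\<close>

lemma noise_orthogonal:
  assumes V: "V \<in> borel_measurable (\<F> k)" and bounded: "AE \<omega> in M. norm (V \<omega>) \<le> B"
  shows "integrable M (\<lambda>\<omega>. (F (X \<omega>) - batch_op Fi (S k \<omega>) (X \<omega>)) \<bullet> V \<omega>)"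
    and "expectation (\<lambda>\<omega>. (F (X \<omega>) - batch_op Fi (S k \<omega>) (X \<omega>)) \<bullet> V \<omega>) = 0"
proof -
  define \<phi> where "\<phi> s \<omega> = (F (X \<omega>) - batch_op Fi s (X \<omega>)) \<bullet> V \<omega>" for s \<omega>
  have meas: "\<phi> s \<in> borel_measurable (\<F> k)" if "s \<in> batches n b" for s
    unfolding \<phi>_def using F_X_meas batch_X_meas[OF that] V by measurable
  have int: "integrable M (\<phi> s)" if s: "s \<in> batches n b" for s
  proof (rule integrable_const_bound[where B="2 * batch_bound * B"])
    show "\<phi> s \<in> borel_measurable M" by (rule meas_M[OF meas[OF s]])
    show "AE \<omega> in M. norm (\<phi> s \<omega>) \<le> 2 * batch_bound * B"
      using near bounded
    proof eventually_elim
      case (elim \<omega>)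
      have "norm (\<phi> s \<omega>) \<le> norm (F (X \<omega>) - batch_op Fi s (X \<omega>)) * norm (V \<omega>)"
        unfolding \<phi>_def real_norm_def by (rule Cauchy_Schwarz_ineq2)
      also have "\<dots> \<le> 2 * batch_bound * B"
        using elim batch_bound_nonneg by (intro mult_mono noise_norm_bound[OF s]) auto
      finally show ?case .
    qed
  qed
  have zero: "(\<Sum>s\<in>batches n b. \<phi> s \<omega>) = 0" for \<omega>
  proof -
    have "(\<Sum>s\<in>batches n b. \<phi> s \<omega>) = (\<Sum>s\<in>batches n b. F (X \<omega>) - batch_op Fi s (X \<omega>)) \<bullet> V \<omega>"
      by (simp add: \<phi>_def inner_sum_left)
    also have "(\<Sum>s\<in>batches n b. F (X \<omega>) - batch_op Fi s (X \<omega>)) = 0"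
      by (simp add: sum_subtractf batch_mean sum_constant_scaleR card_batches del: sum_constant)
    finally show ?thesis by simp
  qed
  show "integrable M (\<lambda>\<omega>. (F (X \<omega>) - batch_op Fi (S k \<omega>) (X \<omega>)) \<bullet> V \<omega>)"
    using fresh_sample(1)[of \<phi>, OF meas int] by (simp add: \<phi>_def)
  show "expectation (\<lambda>\<omega>. (F (X \<omega>) - batch_op Fi (S k \<omega>) (X \<omega>)) \<bullet> V \<omega>) = 0"
    using fresh_sample(2)[of \<phi>, OF meas int] by (simp add: zero) (simp add: \<phi>_def)
qed

lemma fresh_sample_bound:
  assumes meas: "\<And>s. s \<in> batches n b \<Longrightarrow> \<phi> s \<in> borel_measurable (borel :: 'v measure)"
    and bounded: "\<And>s y. s \<in> batches n b \<Longrightarrow> norm (y - xstar) \<le> D \<Longrightarrow> \<bar>\<phi> s y\<bar> \<le> B"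
    and average: "\<And>y. norm (y - xstar) \<le> D \<Longrightarrow> (\<Sum>s\<in>batches n b. \<phi> s y) \<le> real (n ^ b) * c"
  shows "integrable M (\<lambda>\<omega>. \<phi> (S k \<omega>) (X \<omega>) :: real)"
    and "expectation (\<lambda>\<omega>. \<phi> (S k \<omega>) (X \<omega>)) \<le> c"
proof -
  have m: "(\<lambda>\<omega>. \<phi> s (X \<omega>)) \<in> borel_measurable (\<F> k)" if "s \<in> batches n b" for s
    by (rule measurable_compose[OF X meas[OF that]])
  have int: "integrable M (\<lambda>\<omega>. \<phi> s (X \<omega>))" if s: "s \<in> batches n b" for s
  proof (rule integrable_const_bound[where B=B])
    show "AE \<omega> in M. norm (\<phi> s (X \<omega>)) \<le> B"
      using near by eventually_elim (simp add: bounded[OF s])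
  qed (rule meas_M[OF m[OF s]])
  show "integrable M (\<lambda>\<omega>. \<phi> (S k \<omega>) (X \<omega>))"
    by (rule fresh_sample(1)[of "\<lambda>s \<omega>. \<phi> s (X \<omega>)", OF m int])
  have "expectation (\<lambda>\<omega>. \<phi> (S k \<omega>) (X \<omega>)) = expectation (\<lambda>\<omega>. (\<Sum>s\<in>batches n b. \<phi> s (X \<omega>)) / real (n ^ b))"
    by (rule fresh_sample(2)[of "\<lambda>s \<omega>. \<phi> s (X \<omega>)", OF m int])
  also have "\<dots> \<le> expectation (\<lambda>_. c)"
  proof (rule integral_mono_AE)
    show "AE \<omega> in M. (\<Sum>s\<in>batches n b. \<phi> s (X \<omega>)) / real (n ^ b) \<le> c"
      using near
      by eventually_elim (use average card_pos in \<open>simp add: pos_divide_le_eq mult.commute\<close>)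
  qed (use int in auto)
  finally show "expectation (\<lambda>\<omega>. \<phi> (S k \<omega>) (X \<omega>)) \<le> c" by (simp add: prob_space)
qed

lemma noise_second_moment:
  "integrable M (\<lambda>\<omega>. (norm (F (X \<omega>) - batch_op Fi (S k \<omega>) (X \<omega>)))\<^sup>2)"
  "expectation (\<lambda>\<omega>. (norm (F (X \<omega>) - batch_op Fi (S k \<omega>) (X \<omega>)))\<^sup>2) \<le> \<sigma>\<^sup>2"
proof -
  have m: "(\<lambda>y. (norm (F y - batch_op Fi s y))\<^sup>2) \<in> borel_measurable borel" if "s \<in> batches n b" for s
    using F_meas batch_meas[OF that] by measurable
  have B: "\<bar>(norm (F y - batch_op Fi s y))\<^sup>2\<bar> \<le> (2 * batch_bound)\<^sup>2"
    if "s \<in> batches n b" "norm (y - xstar) \<le> D" for s y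
    using power_mono[OF noise_norm_bound[OF that], of 2] by simp
  note * = fresh_sample_bound[of "\<lambda>s y. (norm (F y - batch_op Fi s y))\<^sup>2", OF m B batch_second_moment]
  show "integrable M (\<lambda>\<omega>. (norm (F (X \<omega>) - batch_op Fi (S k \<omega>) (X \<omega>)))\<^sup>2)"
    by (rule *(1))
  show "expectation (\<lambda>\<omega>. (norm (F (X \<omega>) - batch_op Fi (S k \<omega>) (X \<omega>)))\<^sup>2) \<le> \<sigma>\<^sup>2"
    by (rule *(2))
qed

lemma extrapolation_error:
  "integrable M (\<lambda>\<omega>. 3 * L * D * norm (batch_op Fi (S k \<omega>) (X \<omega>))
    + norm (F (X \<omega>) - batch_op Fi (S k \<omega>) (X \<omega>)) * norm (batch_op Fi (S k \<omega>) (X \<omega>)))"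
  "expectation (\<lambda>\<omega>. 3 * L * D * norm (batch_op Fi (S k \<omega>) (X \<omega>))
    + norm (F (X \<omega>) - batch_op Fi (S k \<omega>) (X \<omega>)) * norm (batch_op Fi (S k \<omega>) (X \<omega>)))
    \<le> \<sigma>\<^sup>2 + 9 * L\<^sup>2 * D\<^sup>2"
proof -
  let ?\<phi> = "\<lambda>s y. 3 * L * D * norm (batch_op Fi s y) + norm (F y - batch_op Fi s y) * norm (batch_op Fi s y)"
  have m: "?\<phi> s \<in> borel_measurable borel" if "s \<in> batches n b" for s
    using F_meas batch_meas[OF that] by measurable
  have B: "\<bar>?\<phi> s y\<bar> \<le> 3 * L * D * batch_bound + 2 * batch_bound * batch_bound"
    if "s \<in> batches n b" "norm (y - xstar) \<le> D" for s y
  proof -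
    have "?\<phi> s y \<ge> 0" using L D by simp
    moreover have "?\<phi> s y \<le> 3 * L * D * batch_bound + 2 * batch_bound * batch_bound"
      using L D batch_bound_nonneg
      by (intro add_mono mult_mono mult_left_mono batch_norm_bound noise_norm_bound that) auto
    ultimately show ?thesis by simp
  qed
  note * = fresh_sample_bound[of ?\<phi>, OF m B batch_extrapolation_error]
  show "integrable M (\<lambda>\<omega>. ?\<phi> (S k \<omega>) (X \<omega>))"
    by (rule *(1))
  show "expectation (\<lambda>\<omega>. ?\<phi> (S k \<omega>) (X \<omega>)) \<le> \<sigma>\<^sup>2 + 9 * L\<^sup>2 * D\<^sup>2"
    by (rule *(2))
qed

end

text \<open>Orthogonality of the martingale differences \<open>e\<^sub>k\<close>. Measurability and a bound on the partial sums
  belong to the induction because \<open>noise_orthogonal\<close> is applied to them.\<close>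

lemma noise_sum_second_moment:
  assumes X: "\<And>k. X k \<in> borel_measurable (\<F> k)"
    and near: "\<And>k. AE \<omega> in M. norm (X k \<omega> - xstar) \<le> D"
  defines "e \<equiv> \<lambda>k \<omega>. F (X k \<omega>) - batch_op Fi (S k \<omega>) (X k \<omega>)"
  shows "(\<lambda>\<omega>. \<Sum>k=0..K. e k \<omega>) \<in> borel_measurable (\<F> (Suc K))"
    and "AE \<omega> in M. norm (\<Sum>k=0..K. e k \<omega>) \<le> real (K + 1) * (2 * batch_bound)"
    and "integrable M (\<lambda>\<omega>. (norm (\<Sum>k=0..K. e k \<omega>))\<^sup>2)"
    and "expectation (\<lambda>\<omega>. (norm (\<Sum>k=0..K. e k \<omega>))\<^sup>2) \<le> real (K + 1) * \<sigma>\<^sup>2"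
proof -
  have e_eq: "F (X k \<omega>) - batch_op Fi (S k \<omega>) (X k \<omega>) = e k \<omega>" for k \<omega>
    by (simp add: e_def)
  note e_meas = noise_meas[OF X near, unfolded e_eq]
  note e_bound = noise_bound_AE[OF X near, unfolded e_eq]
  have "(\<lambda>\<omega>. \<Sum>k=0..K. e k \<omega>) \<in> borel_measurable (\<F> (Suc K)) \<and>
    (AE \<omega> in M. norm (\<Sum>k=0..K. e k \<omega>) \<le> real (K + 1) * (2 * batch_bound)) \<and>
    integrable M (\<lambda>\<omega>. (norm (\<Sum>k=0..K. e k \<omega>))\<^sup>2) \<and>
    expectation (\<lambda>\<omega>. (norm (\<Sum>k=0..K. e k \<omega>))\<^sup>2) \<le> real (K + 1) * \<sigma>\<^sup>2"
  proof (induction K)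
    case 0
    then show ?case
      using e_meas[of 0] e_bound[of 0] noise_second_moment[OF X[of 0] near[of 0], unfolded e_eq] by simp
  next
    case (Suc K)
    define N where "N \<omega> = (\<Sum>k=0..K. e k \<omega>)" for \<omega>
    have IH: "N \<in> borel_measurable (\<F> (Suc K))"
      "AE \<omega> in M. norm (N \<omega>) \<le> real (K + 1) * (2 * batch_bound)"
      "integrable M (\<lambda>\<omega>. (norm (N \<omega>))\<^sup>2)" "expectation (\<lambda>\<omega>. (norm (N \<omega>))\<^sup>2) \<le> real (K + 1) * \<sigma>\<^sup>2"
      using Suc unfolding N_def by auto
    let ?e = "e (Suc K)"
    have sum: "(\<Sum>k=0..Suc K. e k \<omega>) = N \<omega> + ?e \<omega>" for \<omega> by (simp add: N_def)
    note orth = noise_orthogonal[OF X near IH(1,2), unfolded e_eq]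
    note sq = noise_second_moment[OF X near, of "Suc K", unfolded e_eq]
    have "(\<lambda>\<omega>. N \<omega> + ?e \<omega>) \<in> borel_measurable (\<F> (Suc (Suc K)))"
      using meas_later[OF IH(1), of "Suc (Suc K)"] e_meas[of "Suc K"] by simp
    moreover have "AE \<omega> in M. norm (N \<omega> + ?e \<omega>) \<le> real (Suc K + 1) * (2 * batch_bound)"
      using IH(2) e_bound[of "Suc K"]
    proof eventually_elim
      case (elim \<omega>)
      then show ?case
        using norm_triangle_ineq[of "N \<omega>" "?e \<omega>"] by (simp add: algebra_simps)
    qed
    moreover have expand: "(norm (N \<omega> + ?e \<omega>))\<^sup>2 = (norm (N \<omega>))\<^sup>2 + 2 * (?e \<omega> \<bullet> N \<omega>) + (norm (?e \<omega>))\<^sup>2" for \<omega>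
      by (simp add: power2_norm_eq_inner inner_add inner_commute)
    moreover have "integrable M (\<lambda>\<omega>. (norm (N \<omega> + ?e \<omega>))\<^sup>2)"
      unfolding expand using IH(3) orth(1) sq(1) by simp
    moreover have "expectation (\<lambda>\<omega>. (norm (N \<omega> + ?e \<omega>))\<^sup>2) \<le> real (Suc K + 1) * \<sigma>\<^sup>2"
      unfolding expand using IH(3,4) orth sq by (simp add: algebra_simps)
    ultimately show ?case unfolding sum by blast
  qed
  then show "(\<lambda>\<omega>. \<Sum>k=0..K. e k \<omega>) \<in> borel_measurable (\<F> (Suc K))"
    "AE \<omega> in M. norm (\<Sum>k=0..K. e k \<omega>) \<le> real (K + 1) * (2 * batch_bound)"
    "integrable M (\<lambda>\<omega>. (norm (\<Sum>k=0..K. e k \<omega>))\<^sup>2)"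
    "expectation (\<lambda>\<omega>. (norm (\<Sum>k=0..K. e k \<omega>))\<^sup>2) \<le> real (K + 1) * \<sigma>\<^sup>2"
    by blast+
qed

lemma noise_sum_expected_norm:
  assumes X: "\<And>k. X k \<in> borel_measurable (\<F> k)"
    and near: "\<And>k. AE \<omega> in M. norm (X k \<omega> - xstar) \<le> D"
  defines "e \<equiv> \<lambda>k \<omega>. F (X k \<omega>) - batch_op Fi (S k \<omega>) (X k \<omega>)"
  shows "integrable M (\<lambda>\<omega>. norm (\<Sum>k=0..K. e k \<omega>))"
    and "expectation (\<lambda>\<omega>. norm (\<Sum>k=0..K. e k \<omega>)) \<le> \<sigma> * sqrt (real K + 1)"
proof -
  have e_eq: "F (X k \<omega>) - batch_op Fi (S k \<omega>) (X k \<omega>) = e k \<omega>" for k \<omega>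
    by (simp add: e_def)
  note m = noise_sum_second_moment[OF X near, of K, unfolded e_eq]
  show int: "integrable M (\<lambda>\<omega>. norm (\<Sum>k=0..K. e k \<omega>))"
    by (rule integrable_const_bound[where B="real (K + 1) * (2 * batch_bound)"])
       (use m(2) meas_M[OF m(1)] in auto)
  \<comment> \<open>A nonnegative variance is the inequality between first and second moments.\<close>
  have "0 \<le> variance (\<lambda>\<omega>. norm (\<Sum>k=0..K. e k \<omega>))" by (rule variance_positive)
  also have "\<dots> = expectation (\<lambda>\<omega>. (norm (\<Sum>k=0..K. e k \<omega>))\<^sup>2)
      - (expectation (\<lambda>\<omega>. norm (\<Sum>k=0..K. e k \<omega>)))\<^sup>2"
    by (rule variance_eq[OF int m(3)])
  finally have "(expectation (\<lambda>\<omega>. norm (\<Sum>k=0..K. e k \<omega>)))\<^sup>2 \<le> (\<sigma> * sqrt (real K + 1))\<^sup>2"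
    using m(4) by (simp add: power_mult_distrib algebra_simps)
  then show "expectation (\<lambda>\<omega>. norm (\<Sum>k=0..K. e k \<omega>)) \<le> \<sigma> * sqrt (real K + 1)"
    by (rule power2_le_imp_le) (use \<sigma>0 in simp)
qed

end

section \<open>The expected residual\<close>

context sampled_operators
begin

text \<open>The point \<open>x\<^sub>k\<close> and the preceding \<open>\<alpha>\<close> are known before step \<open>k\<close>, whereas \<open>xh\<^sub>k\<close> depends on the
  batch of step \<open>k\<close>.\<close>

lemma iterates_meas:
  assumes adapted: "\<And>k. \<gamma> k \<in> borel_measurable (\<F> (Suc k))"
    and run: "\<And>\<omega>. \<omega> \<in> space M \<Longrightarrow> polyak_seg_iterates (\<lambda>k. batch_op Fi (S k \<omega>)) (\<lambda>k. \<gamma> k \<omega>) x0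
                 (\<lambda>k. x k \<omega>) (\<lambda>k. xh k \<omega>) (\<lambda>k. \<alpha> k \<omega>)"
  shows "x k \<in> borel_measurable (\<F> k)" and "xh k \<in> borel_measurable (\<F> (Suc k))"
proof -
  have cong: "f \<in> borel_measurable (\<F> j)" if "g \<in> borel_measurable (\<F> j)" "\<And>\<omega>. \<omega> \<in> space M \<Longrightarrow> f \<omega> = g \<omega>"
    for f g :: "'w \<Rightarrow> 'z::topological_space" and j
    using that by (subst measurable_cong[of "\<F> j" f g]) (auto simp: space_\<F>)
  have xh_eq: "xh k \<omega> = x k \<omega> - \<gamma> k \<omega> *\<^sub>R batch_op Fi (S k \<omega>) (x k \<omega>)" if "\<omega> \<in> space M" for k \<omega>
    using run[OF that] unfolding polyak_seg_iterates_def by blast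
  have \<alpha>_eq: "\<alpha> k \<omega> = min (ereal (if batch_op Fi (S k \<omega>) (xh k \<omega>) = 0 then \<gamma> k \<omega>
        else (batch_op Fi (S k \<omega>) (xh k \<omega>) \<bullet> (x k \<omega> - xh k \<omega>)) / (norm (batch_op Fi (S k \<omega>) (xh k \<omega>)))\<^sup>2))
      (prev \<infinity> (\<lambda>j. \<alpha> j \<omega>) k)" if "\<omega> \<in> space M" for k \<omega>
    using run[OF that] unfolding polyak_seg_iterates_def by blast
  have x_eq: "x (Suc k) \<omega> = x k \<omega> - real_of_ereal (\<alpha> k \<omega>) *\<^sub>R batch_op Fi (S k \<omega>) (xh k \<omega>)"
    if "\<omega> \<in> space M" for k \<omega>
    using run[OF that] unfolding polyak_seg_iterates_def by blast
  have xh_meas: "xh k \<in> borel_measurable (\<F> (Suc k))" if "x k \<in> borel_measurable (\<F> k)" for k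
  proof (rule cong[OF _ xh_eq])
    have x: "x k \<in> borel_measurable (\<F> (Suc k))" by (rule meas_later[OF that]) simp
    show "(\<lambda>\<omega>. x k \<omega> - \<gamma> k \<omega> *\<^sub>R batch_op Fi (S k \<omega>) (x k \<omega>)) \<in> borel_measurable (\<F> (Suc k))"
      by (intro borel_measurable_diff borel_measurable_scaleR x adapted sampled_meas)
  qed
  have "x k \<in> borel_measurable (\<F> k) \<and> (\<lambda>\<omega>. prev \<infinity> (\<lambda>j. \<alpha> j \<omega>) k) \<in> borel_measurable (\<F> k)" for k
  proof (induction k)
    case 0
    have "x 0 \<in> borel_measurable (\<F> 0)"
      by (rule cong[of "\<lambda>_. x0"]) (use run[unfolded polyak_seg_iterates_def] in auto)
    then show ?case by (simp add: prev_def)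
  next
    case (Suc k)
    then have x: "x k \<in> borel_measurable (\<F> (Suc k))"
      and p: "(\<lambda>\<omega>. prev \<infinity> (\<lambda>j. \<alpha> j \<omega>) k) \<in> borel_measurable (\<F> (Suc k))"
      by (auto intro: meas_later[of _ k])
    have xh: "xh k \<in> borel_measurable (\<F> (Suc k))" using xh_meas Suc by blast
    have h: "(\<lambda>\<omega>. batch_op Fi (S k \<omega>) (xh k \<omega>)) \<in> borel_measurable (\<F> (Suc k))"
      by (rule sampled_meas[OF xh])
    note [measurable] = x p xh h adapted[of k]
    have \<alpha>[measurable]: "\<alpha> k \<in> borel_measurable (\<F> (Suc k))"
      by (rule cong[OF _ \<alpha>_eq]) measurable
    have "x (Suc k) \<in> borel_measurable (\<F> (Suc k))"
      by (rule cong[OF _ x_eq]) measurable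
    then show ?case using \<alpha> by (simp add: prev_def)
  qed
  then show x: "x k \<in> borel_measurable (\<F> k)" for k by blast
  show "xh k \<in> borel_measurable (\<F> (Suc k))" by (rule xh_meas[OF x])
qed

end

lemma (in bounded_noise) expected_residual:
  assumes A: "0 < A" "A < 1" and \<gamma>m1: "\<gamma>m1 > 0" and \<gamma>low: "\<gamma>low > 0"
    and mono: "monotone_operator F"
    and c: "\<And>k. c k = sqrt (real k + 1)"
    and adapted: "\<And>k. \<gamma> k \<in> borel_measurable (\<F> (Suc k))"
    and run: "\<And>\<omega>. \<omega> \<in> space M \<Longrightarrow> dec_polyak_seg 1 c \<gamma>m1 (\<lambda>k. batch_op Fi (S k \<omega>)) (\<lambda>k. \<gamma> k \<omega>) x0
                 (\<lambda>k. x k \<omega>) (\<lambda>k. xh k \<omega>) (\<lambda>k. \<alpha> k \<omega>)"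
    and crit: "AE \<omega> in M. critical_condition A (\<lambda>k. batch_op Fi (S k \<omega>)) (\<lambda>k. x k \<omega>) (\<lambda>k. xh k \<omega>)"
    and C: "convex C" "\<And>y z. y \<in> C \<Longrightarrow> z \<in> C \<Longrightarrow> norm (y - z) \<le> D"
    and xstar: "xstar \<in> C" "F xstar = 0"
    and inC: "AE \<omega> in M. \<forall>k. x k \<omega> \<in> C \<and> xh k \<omega> \<in> C"
    and lower: "AE \<omega> in M. \<forall>k. \<gamma> k \<omega> \<ge> \<gamma>low / sqrt (real k + 1)"
  shows "integrable M (\<lambda>\<omega>. (norm (F ((1 / real (K + 1)) *\<^sub>R (\<Sum>k=0..K. xh k \<omega>))))\<^sup>2)"
    and "expectation (\<lambda>\<omega>. (norm (F ((1 / real (K + 1)) *\<^sub>R (\<Sum>k=0..K. xh k \<omega>))))\<^sup>2)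
      \<le> 4 * L / sqrt (real K + 1) * (9 * (1 + A) * D\<^sup>2 / (8 * \<gamma>low) + 3 * \<sigma> * D / 2
         + 2 * \<gamma>m1 / (1 - A) * (\<sigma>\<^sup>2 + 9 * L\<^sup>2 * D\<^sup>2))"
proof -
  have it: "\<omega> \<in> space M \<Longrightarrow> polyak_seg_iterates (\<lambda>k. batch_op Fi (S k \<omega>)) (\<lambda>k. \<gamma> k \<omega>) x0
                 (\<lambda>k. x k \<omega>) (\<lambda>k. xh k \<omega>) (\<lambda>k. \<alpha> k \<omega>)" for \<omega>
    using run unfolding dec_polyak_seg_def by blast
  note meas = iterates_meas[OF adapted it]
  define e where "e k \<omega> = F (x k \<omega>) - batch_op Fi (S k \<omega>) (x k \<omega>)" for k \<omega>
  define w where "w k \<omega> = 3 * L * D * norm (batch_op Fi (S k \<omega>) (x k \<omega>))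
      + norm (e k \<omega>) * norm (batch_op Fi (S k \<omega>) (x k \<omega>))" for k \<omega>
  define f where "f \<omega> = (norm (F ((1 / real (K + 1)) *\<^sub>R (\<Sum>k=0..K. xh k \<omega>))))\<^sup>2" for \<omega>
  define R where "R \<omega> = 4 * L / real (K + 1) *
    (9 * (1 + A) * D\<^sup>2 / (8 * \<gamma>low) * sqrt (real K + 1)
     + (\<Sum>k=0..K. e k \<omega> \<bullet> (x k \<omega> - x0)) + 3 * D / 2 * norm (\<Sum>k=0..K. e k \<omega>)
     + (\<Sum>k=0..K. \<gamma>m1 / sqrt (real k + 1) * w k \<omega>))" for \<omega>
  have near: "AE \<omega> in M. norm (x k \<omega> - xstar) \<le> D" for k
    using inC by eventually_elim (use C xstar in auto)
  have fR: "AE \<omega> in M. f \<omega> \<le> R \<omega>"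
    using crit inC lower AE_space
  proof eventually_elim
    case (elim \<omega>)
    note r = run[OF elim(4)]
    have G: "norm (batch_op Fi (S k \<omega>) y - batch_op Fi (S k \<omega>) z) \<le> L * norm (y - z)" for k y z
      by (rule batch_lip[OF S_in[OF elim(4)]])
    show ?case
      unfolding f_def R_def w_def e_def
    proof (rule residual_pathwise_bound[OF A L \<gamma>low F_lip G mono it[OF elim(4)] _ _ _ _ elim(1) C _ _ xstar])
      show "\<gamma> k \<omega> > 0" for k using r unfolding dec_polyak_seg_def by blast
      show "\<gamma> (Suc k) \<omega> \<le> \<gamma> k \<omega>" for k by (rule dec_polyak_seg_step_decreasing[OF c r])
      show "\<gamma> k \<omega> \<le> \<gamma>m1 / sqrt (real k + 1)" for k by (rule dec_polyak_seg_step_upper[OF c r])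
    qed (use elim in auto)
  qed
  have V: "(\<lambda>\<omega>. x k \<omega> - x0) \<in> borel_measurable (\<F> k)" for k
    using meas(1)[of k] by simp
  have x0: "\<omega> \<in> space M \<Longrightarrow> x0 = x 0 \<omega>" for \<omega>
    using it unfolding polyak_seg_iterates_def by blast
  have VB: "AE \<omega> in M. norm (x k \<omega> - x0) \<le> D" for k
    using inC AE_space by eventually_elim (use C x0 in auto)
  note orth = noise_orthogonal[OF meas(1) near V VB, folded e_def]
  note drift = noise_sum_expected_norm[OF meas(1) near, of K, folded e_def]
  note extra = extrapolation_error[OF meas(1) near, folded e_def, folded w_def]
  have intR: "integrable M R"
    unfolding R_def using orth(1) drift(1) extra(1) by (intro integrable_mult_right
      Bochner_Integration.integrable_add Bochner_Integration.integrable_sum integrable_const) auto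
  have fm: "f \<in> borel_measurable M"
  proof -
    have "xh k \<in> borel_measurable M" for k by (rule meas_M[OF meas(2)])
    then have "(\<lambda>\<omega>. (1 / real (K + 1)) *\<^sub>R (\<Sum>k=0..K. xh k \<omega>)) \<in> borel_measurable M" by measurable
    from measurable_compose[OF this F_meas] show ?thesis unfolding f_def by measurable
  qed
  have intf: "integrable M f"
  proof (rule Bochner_Integration.integrable_bound[OF intR fm])
    show "AE \<omega> in M. norm (f \<omega>) \<le> norm (R \<omega>)"
      using fR by eventually_elim (auto simp: f_def)
  qed
  let ?Q = "\<sigma>\<^sup>2 + 9 * L\<^sup>2 * D\<^sup>2"
  let ?q = "sqrt (real K + 1)"
  have cancel: "4 * L * q / (q * q) = 4 * L / q" for q :: real by simp
  have Q: "?Q \<ge> 0" by simp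
  have "expectation f \<le> expectation R" by (rule integral_mono_AE[OF intf intR fR])
  also have "expectation R = 4 * L / real (K + 1) *
    (9 * (1 + A) * D\<^sup>2 / (8 * \<gamma>low) * ?q + 3 * D / 2 * expectation (\<lambda>\<omega>. norm (\<Sum>k=0..K. e k \<omega>))
     + (\<Sum>k=0..K. \<gamma>m1 / sqrt (real k + 1) * expectation (w k)))"
    unfolding R_def using orth drift(1) extra(1) by (simp add: prob_space)
  also have "\<dots> \<le> 4 * L / real (K + 1) *
    (9 * (1 + A) * D\<^sup>2 / (8 * \<gamma>low) * ?q + 3 * D / 2 * (\<sigma> * ?q) + 2 * \<gamma>m1 / (1 - A) * ?Q * ?q)"
  proof (intro mult_left_mono add_mono order_refl)
    show "expectation (\<lambda>\<omega>. norm (\<Sum>k=0..K. e k \<omega>)) \<le> \<sigma> * ?q" by (rule drift(2))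
    have "(\<Sum>k=0..K. \<gamma>m1 / sqrt (real k + 1) * expectation (w k))
        \<le> (\<Sum>k=0..K. \<gamma>m1 / sqrt (real k + 1) * ?Q)"
      using extra(2) \<gamma>m1 by (intro sum_mono mult_left_mono) auto
    also have "\<dots> = \<gamma>m1 * ?Q * (\<Sum>k=0..K. 1 / sqrt (real k + 1))"
      unfolding sum_distrib_left by (intro sum.cong refl) simp
    also have "\<dots> \<le> \<gamma>m1 * ?Q * (2 * ?q)"
      using \<gamma>m1 Q by (intro mult_left_mono sum_inverse_sqrt_le) auto
    also have "\<dots> = 2 * \<gamma>m1 * ?Q * ?q * 1" by simp
    also have "\<dots> \<le> 2 * \<gamma>m1 * ?Q * ?q * (1 / (1 - A))"
      using \<gamma>m1 A by (intro mult_left_mono) auto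
    finally show "(\<Sum>k=0..K. \<gamma>m1 / sqrt (real k + 1) * expectation (w k)) \<le> 2 * \<gamma>m1 / (1 - A) * ?Q * ?q"
      by (simp add: mult_ac)
  qed (use D L A \<gamma>low in auto)
  also have "\<dots> = 4 * L * ?q / (?q * ?q) *
     (9 * (1 + A) * D\<^sup>2 / (8 * \<gamma>low) + 3 * \<sigma> * D / 2 + 2 * \<gamma>m1 / (1 - A) * ?Q)"
  proof -
    have *: "4 * L / N * (a * q + 3 * D / 2 * (\<sigma> * q) + t * q) = 4 * L * q / N * (a + 3 * \<sigma> * D / 2 + t)"
      for a q t N :: real
      by (simp add: algebra_simps)
    have "?q * ?q = real (K + 1)" by simp
    then show ?thesis unfolding * by (simp only:)
  qed
  finally have "expectation f \<le> 4 * L / ?q *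
     (9 * (1 + A) * D\<^sup>2 / (8 * \<gamma>low) + 3 * \<sigma> * D / 2 + 2 * \<gamma>m1 / (1 - A) * ?Q)"
    unfolding cancel .
  with intf show "integrable M (\<lambda>\<omega>. (norm (F ((1 / real (K + 1)) *\<^sub>R (\<Sum>k=0..K. xh k \<omega>))))\<^sup>2)"
    "expectation (\<lambda>\<omega>. (norm (F ((1 / real (K + 1)) *\<^sub>R (\<Sum>k=0..K. xh k \<omega>))))\<^sup>2)
      \<le> 4 * L / ?q * (9 * (1 + A) * D\<^sup>2 / (8 * \<gamma>low) + 3 * \<sigma> * D / 2
         + 2 * \<gamma>m1 / (1 - A) * ?Q)"
    unfolding f_def by auto
qed

section \<open>The two step-size rules\<close>

text \<open>All steps are at most \<open>A / L\<close>, and \<open>c\<^sub>k \<gamma>\<^sub>k\<close> is constant.\<close>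

lemma constant_rule:
  fixes G :: "nat \<Rightarrow> 'v \<Rightarrow> 'v::real_inner"
  assumes lip: "\<And>k y z. norm (G k y - G k z) \<le> L * norm (y - z)" and pos: "L > 0" "A > 0"
    and c: "\<And>k. c k = sqrt (real k + 1)"
    and \<gamma>: "\<And>k. \<gamma> k = A / (L * sqrt (real k + 1))"
    and it: "polyak_seg_iterates G \<gamma> x0 x xh \<alpha>"
  shows "dec_polyak_seg 1 c (A / L) G \<gamma> x0 x xh \<alpha>" and "critical_condition A G x xh"
proof -
  have "\<gamma> k \<le> prev 1 c k / c k * prev (A / L) \<gamma> k" for k
    by (cases k) (simp_all add: prev_def \<gamma> c mult.commute)
  then show "dec_polyak_seg 1 c (A / L) G \<gamma> x0 x xh \<alpha>"
    using it pos by (simp add: dec_polyak_seg_def \<gamma>)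
  show "critical_condition A G x xh"
    unfolding critical_condition_def
  proof
    fix k
    have "\<gamma> k \<le> A / L" unfolding \<gamma> using pos by (intro divide_left_mono) auto
    moreover have "\<gamma> k \<ge> 0" using pos by (simp add: \<gamma>)
    moreover have "xh k = x k - \<gamma> k *\<^sub>R G k (x k)" using it by (simp add: polyak_seg_iterates_def)
    ultimately show "norm (G k (xh k) - G k (x k)) \<le> A * norm (G k (x k))"
      using lipschitz_step_critical[OF lip pos(1), of "\<gamma> k" A k "x k"] by (simp add: norm_minus_commute)
  qed
qed

text \<open>Backtracking either keeps the proposed step, and then \<open>c\<^sub>k \<gamma>\<^sub>k = c\<^sub>k\<^sub>-\<^sub>1 \<gamma>\<^sub>k\<^sub>-\<^sub>1\<close>, or it stops above
  \<open>A / (\<beta> L)\<close>, and then \<open>c\<^sub>k \<ge> 1\<close> gives the bound.\<close>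

lemma line_search_rule:
  fixes G :: "nat \<Rightarrow> 'v \<Rightarrow> 'v::real_inner"
  assumes lip: "\<And>k y z. norm (G k y - G k z) \<le> L * norm (y - z)"
    and pos: "L > 0" "A > 0" "\<beta> > 1" "\<gamma>m1 > 0"
    and c: "\<And>k. c k = sqrt (real k + 1)"
    and ls: "dec_polyak_seg_ls \<beta> A 1 c \<gamma>m1 G \<gamma> x0 x xh \<alpha>"
  shows "dec_polyak_seg 1 c \<gamma>m1 G \<gamma> x0 x xh \<alpha>" and "critical_condition A G x xh"
    and "min \<gamma>m1 (A / (\<beta> * L)) / sqrt (real k + 1) \<le> \<gamma> k"
proof -
  define g where "g k = prev 1 c k / c k * prev \<gamma>m1 \<gamma> k" for k
  have it: "polyak_seg_iterates G \<gamma> x0 x xh \<alpha>" and \<gamma>: "\<gamma> k = backtrack \<beta> A (G k) (x k) (g k)" for k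
    using ls by (auto simp: dec_polyak_seg_ls_def g_def)
  note bt = backtrack_correct[OF lip pos(1,2,3), of "g k" k "x k" for k, folded \<gamma>]
  have gpos: "g k > 0" for k
  proof (induction k)
    case 0
    then show ?case using pos by (simp add: g_def prev_def c)
  next
    case (Suc k)
    then have "\<gamma> k > 0" using bt by blast
    then show ?case by (simp add: g_def prev_def c add_nonneg_pos)
  qed
  note bt = bt[OF gpos]
  show "dec_polyak_seg 1 c \<gamma>m1 G \<gamma> x0 x xh \<alpha>"
    using it bt by (simp add: dec_polyak_seg_def g_def)
  show "critical_condition A G x xh"
    using bt it by (simp add: critical_condition_def polyak_seg_iterates_def norm_minus_commute)
  let ?m = "min \<gamma>m1 (A / (\<beta> * L))"
  have step: "min (c k * g k) (A / (\<beta> * L)) \<le> c k * \<gamma> k" for k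
  proof -
    have ck: "c k \<ge> 1" by (simp add: c)
    have "min (g k) (A / (\<beta> * L)) \<le> \<gamma> k" using bt by blast
    then consider "g k \<le> \<gamma> k" | "A / (\<beta> * L) \<le> \<gamma> k" by linarith
    then show ?thesis
    proof cases
      case 1
      then have "c k * g k \<le> c k * \<gamma> k" using ck by (intro mult_left_mono) auto
      then show ?thesis by linarith
    next
      case 2
      have "\<gamma> k > 0" using bt by blast
      then have "1 * \<gamma> k \<le> c k * \<gamma> k" using ck by (intro mult_right_mono) auto
      with 2 show ?thesis by linarith
    qed
  qed
  have "?m \<le> c k * \<gamma> k"
  proof (induction k)
    case 0
    then show ?case using step[of 0] by (simp add: g_def prev_def c)
  next
    case (Suc k)
    have "c (Suc k) * g (Suc k) = c k * \<gamma> k"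
      using c[of "Suc k"] by (simp add: g_def prev_def)
    with Suc step[of "Suc k"] show ?case by linarith
  qed
  then show "?m / sqrt (real k + 1) \<le> \<gamma> k" by (simp add: c field_simps)
qed

theorem corollary4p7:
  fixes Fi :: "nat \<Rightarrow> real ^ 'd \<Rightarrow> real ^ 'd"
    and F :: "real ^ 'd \<Rightarrow> real ^ 'd"
    and M :: "'w measure"
    and \<F> :: "nat \<Rightarrow> 'w measure"
    and S :: "nat \<Rightarrow> 'w \<Rightarrow> nat list"
    and n b :: nat
    and L A \<gamma>m1 :: real
    and c :: "nat \<Rightarrow> real"
    and \<gamma> :: "nat \<Rightarrow> 'w \<Rightarrow> real"
    and x0 :: "real ^ 'd"
    and x xh :: "nat \<Rightarrow> 'w \<Rightarrow> real ^ 'd"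
    and \<alpha> :: "nat \<Rightarrow> 'w \<Rightarrow> ereal"
  assumes n: "n \<ge> 1" and b: "b \<ge> 1"
    and L: "L > 0"
    and lipschitz: "\<And>i. i \<in> {1..n} \<Longrightarrow> L-lipschitz_on UNIV (Fi i)"
    and F: "\<And>y. F y = (1 / real n) *\<^sub>R (\<Sum>i=1..n. Fi i y)"
    and monotone: "monotone_operator F"
    and A: "0 < A" "A < 1"
    and \<gamma>m1: "\<gamma>m1 > 0"
    and c: "\<And>k. c k = sqrt (real k + 1)"
    and sampling: "batch_sampling M \<F> n b S"
    and adapted: "\<And>k. \<gamma> k \<in> borel_measurable (\<F> (Suc k))"
  shows
    "(\<forall>C xstar D \<sigma> \<gamma>low.
        (\<forall>\<omega>\<in>space M. dec_polyak_seg 1 c \<gamma>m1 (\<lambda>k. batch_op Fi (S k \<omega>)) (\<lambda>k. \<gamma> k \<omega>) x0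
                         (\<lambda>k. x k \<omega>) (\<lambda>k. xh k \<omega>) (\<lambda>k. \<alpha> k \<omega>)) \<longrightarrow>
        (AE \<omega> in M. critical_condition A (\<lambda>k. batch_op Fi (S k \<omega>)) (\<lambda>k. x k \<omega>) (\<lambda>k. xh k \<omega>)) \<longrightarrow>
        compact C \<longrightarrow> convex C \<longrightarrow> D = diameter C \<longrightarrow> xstar \<in> C \<longrightarrow> F xstar = 0 \<longrightarrow>
        (AE \<omega> in M. \<forall>k. x k \<omega> \<in> C \<and> xh k \<omega> \<in> C) \<longrightarrow>
        \<sigma> \<ge> 0 \<longrightarrow>
        \<sigma>\<^sup>2 = 2 * L\<^sup>2 * D\<^sup>2
              + 2 * (\<integral>s. (norm (batch_op Fi s xstar))\<^sup>2 \<partial>uniform_count_measure (batches n b)) \<longrightarrow>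
        \<gamma>low > 0 \<longrightarrow>
        (AE \<omega> in M. \<forall>k. \<gamma> k \<omega> \<ge> \<gamma>low / sqrt (real k + 1)) \<longrightarrow>
        (\<forall>K. integrable M (\<lambda>\<omega>. (norm (F ((1 / real (K + 1)) *\<^sub>R (\<Sum>k=0..K. xh k \<omega>))))\<^sup>2) \<and>
             (\<integral>\<omega>. (norm (F ((1 / real (K + 1)) *\<^sub>R (\<Sum>k=0..K. xh k \<omega>))))\<^sup>2 \<partial>M)
               \<le> 4 * L / sqrt (real K + 1) *
                  (9 * (1 + A) * D\<^sup>2 / (8 * \<gamma>low) + 3 * \<sigma> * D / 2
                   + 2 * \<gamma>m1 / (1 - A) * (\<sigma>\<^sup>2 + 9 * L\<^sup>2 * D\<^sup>2))) \<and>
        (\<lambda>K. \<integral>\<omega>. (norm (F ((1 / real (K + 1)) *\<^sub>R (\<Sum>k=0..K. xh k \<omega>))))\<^sup>2 \<partial>M)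
          \<in> O(\<lambda>K. 1 / sqrt (real K + 1)))
     \<and>
     (\<gamma>m1 = A / L \<longrightarrow>
      (\<forall>\<omega>\<in>space M. \<forall>k. \<gamma> k \<omega> = A / (L * sqrt (real k + 1))) \<longrightarrow>
      (\<forall>\<omega>\<in>space M. polyak_seg_iterates (\<lambda>k. batch_op Fi (S k \<omega>)) (\<lambda>k. \<gamma> k \<omega>) x0
                       (\<lambda>k. x k \<omega>) (\<lambda>k. xh k \<omega>) (\<lambda>k. \<alpha> k \<omega>)) \<longrightarrow>
      (\<forall>\<omega>\<in>space M. dec_polyak_seg 1 c \<gamma>m1 (\<lambda>k. batch_op Fi (S k \<omega>)) (\<lambda>k. \<gamma> k \<omega>) x0
                       (\<lambda>k. x k \<omega>) (\<lambda>k. xh k \<omega>) (\<lambda>k. \<alpha> k \<omega>)) \<and>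
      (AE \<omega> in M. critical_condition A (\<lambda>k. batch_op Fi (S k \<omega>)) (\<lambda>k. x k \<omega>) (\<lambda>k. xh k \<omega>)) \<and>
      (AE \<omega> in M. \<forall>k. \<gamma> k \<omega> \<ge> (A / L) / sqrt (real k + 1)))
     \<and>
     (\<forall>\<beta>>1.
      (\<forall>\<omega>\<in>space M. dec_polyak_seg_ls \<beta> A 1 c \<gamma>m1 (\<lambda>k. batch_op Fi (S k \<omega>)) (\<lambda>k. \<gamma> k \<omega>) x0
                       (\<lambda>k. x k \<omega>) (\<lambda>k. xh k \<omega>) (\<lambda>k. \<alpha> k \<omega>)) \<longrightarrow>
      (\<forall>\<omega>\<in>space M. dec_polyak_seg 1 c \<gamma>m1 (\<lambda>k. batch_op Fi (S k \<omega>)) (\<lambda>k. \<gamma> k \<omega>) x0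
                       (\<lambda>k. x k \<omega>) (\<lambda>k. xh k \<omega>) (\<lambda>k. \<alpha> k \<omega>)) \<and>
      (AE \<omega> in M. critical_condition A (\<lambda>k. batch_op Fi (S k \<omega>)) (\<lambda>k. x k \<omega>) (\<lambda>k. xh k \<omega>)) \<and>
      (AE \<omega> in M. \<forall>k. \<gamma> k \<omega> \<ge> min \<gamma>m1 (A / (\<beta> * L)) / sqrt (real k + 1)))"
proof (intro conjI allI impI)
  interpret sampled_operators M Fi F \<F> S n b L
  proof (intro sampled_operators.intro sampled_operators_axioms.intro)
    show "prob_space M" using sampling by (simp add: batch_sampling_def)
  qed (use n b L lipschitz F sampling in auto)
  have G: "norm (batch_op Fi (S k \<omega>) y - batch_op Fi (S k \<omega>) z) \<le> L * norm (y - z)"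
    if "\<omega> \<in> space M" for \<omega> k y z
    by (rule batch_lip[OF S_in[OF that]])
  {
    fix C xstar D \<sigma> \<gamma>low
    assume run: "\<forall>\<omega>\<in>space M. dec_polyak_seg 1 c \<gamma>m1 (\<lambda>k. batch_op Fi (S k \<omega>)) (\<lambda>k. \<gamma> k \<omega>) x0
                         (\<lambda>k. x k \<omega>) (\<lambda>k. xh k \<omega>) (\<lambda>k. \<alpha> k \<omega>)"
      and crit: "AE \<omega> in M. critical_condition A (\<lambda>k. batch_op Fi (S k \<omega>)) (\<lambda>k. x k \<omega>) (\<lambda>k. xh k \<omega>)"
      and C: "compact C" "convex C" "D = diameter C" and xstar: "xstar \<in> C" "F xstar = 0"
      and inC: "AE \<omega> in M. \<forall>k. x k \<omega> \<in> C \<and> xh k \<omega> \<in> C"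
      and \<sigma>: "\<sigma> \<ge> 0" "\<sigma>\<^sup>2 = 2 * L\<^sup>2 * D\<^sup>2
              + 2 * (\<integral>s. (norm (batch_op Fi s xstar))\<^sup>2 \<partial>uniform_count_measure (batches n b))"
      and \<gamma>low: "\<gamma>low > 0" and lower: "AE \<omega> in M. \<forall>k. \<gamma> k \<omega> \<ge> \<gamma>low / sqrt (real k + 1)"
    have diam: "norm (y - z) \<le> D" if "y \<in> C" "z \<in> C" for y z
      using diameter_bounded_bound[OF compact_imp_bounded[OF C(1)] that] C(3) by (simp add: dist_norm)
    interpret bounded_noise M Fi F \<F> S n b L xstar D \<sigma>
      by unfold_locales (use diam[OF xstar(1) xstar(1)] \<sigma> in auto)
    let ?f = "\<lambda>K \<omega>. (norm (F ((1 / real (K + 1)) *\<^sub>R (\<Sum>k=0..K. xh k \<omega>))))\<^sup>2"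
    let ?B = "9 * (1 + A) * D\<^sup>2 / (8 * \<gamma>low) + 3 * \<sigma> * D / 2
                   + 2 * \<gamma>m1 / (1 - A) * (\<sigma>\<^sup>2 + 9 * L\<^sup>2 * D\<^sup>2)"
    note res = expected_residual[OF A \<gamma>m1 \<gamma>low monotone c adapted bspec[OF run] crit C(2) diam xstar inC lower]
    show "integrable M (?f K)" for K by (rule res(1))
    show bound: "expectation (?f K) \<le> 4 * L / sqrt (real K + 1) * ?B" for K by (rule res(2))
    show "(\<lambda>K. expectation (?f K)) \<in> O(\<lambda>K. 1 / sqrt (real K + 1))"
    proof (rule bigoI[of _ "4 * L * ?B"], rule always_eventually, rule allI)
      fix K
      have "expectation (?f K) \<ge> 0" by (rule integral_nonneg_AE) simp
      then show "norm (expectation (?f K)) \<le> 4 * L * ?B * norm (1 / sqrt (real K + 1))"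
        using bound[of K] by simp
    qed
  next
    assume \<gamma>: "\<gamma>m1 = A / L" "\<forall>\<omega>\<in>space M. \<forall>k. \<gamma> k \<omega> = A / (L * sqrt (real k + 1))"
      and it: "\<forall>\<omega>\<in>space M. polyak_seg_iterates (\<lambda>k. batch_op Fi (S k \<omega>)) (\<lambda>k. \<gamma> k \<omega>) x0
                       (\<lambda>k. x k \<omega>) (\<lambda>k. xh k \<omega>) (\<lambda>k. \<alpha> k \<omega>)"
    have \<gamma>': "\<gamma> k \<omega> = A / (L * sqrt (real k + 1))" if "\<omega> \<in> space M" for k \<omega>
      using \<gamma>(2) that by blast
    note rule = constant_rule[OF G L A(1) c \<gamma>' bspec[OF it], folded \<gamma>(1)]
    show "\<forall>\<omega>\<in>space M. dec_polyak_seg 1 c \<gamma>m1 (\<lambda>k. batch_op Fi (S k \<omega>)) (\<lambda>k. \<gamma> k \<omega>) x0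
                       (\<lambda>k. x k \<omega>) (\<lambda>k. xh k \<omega>) (\<lambda>k. \<alpha> k \<omega>)"
      using rule(1) by blast
    show "AE \<omega> in M. critical_condition A (\<lambda>k. batch_op Fi (S k \<omega>)) (\<lambda>k. x k \<omega>) (\<lambda>k. xh k \<omega>)"
      by (rule AE_I2) (rule rule(2))
    show "AE \<omega> in M. \<forall>k. \<gamma> k \<omega> \<ge> (A / L) / sqrt (real k + 1)"
      by (rule AE_I2) (simp add: \<gamma>')
  next
    fix \<beta> :: real
    assume \<beta>: "\<beta> > 1"
      and ls: "\<forall>\<omega>\<in>space M. dec_polyak_seg_ls \<beta> A 1 c \<gamma>m1 (\<lambda>k. batch_op Fi (S k \<omega>)) (\<lambda>k. \<gamma> k \<omega>) x0
                       (\<lambda>k. x k \<omega>) (\<lambda>k. xh k \<omega>) (\<lambda>k. \<alpha> k \<omega>)"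
    note rule = line_search_rule[OF G L A(1) \<beta> \<gamma>m1 c bspec[OF ls]]
    show "\<forall>\<omega>\<in>space M. dec_polyak_seg 1 c \<gamma>m1 (\<lambda>k. batch_op Fi (S k \<omega>)) (\<lambda>k. \<gamma> k \<omega>) x0
                       (\<lambda>k. x k \<omega>) (\<lambda>k. xh k \<omega>) (\<lambda>k. \<alpha> k \<omega>)"
      using rule(1) by blast
    show "AE \<omega> in M. critical_condition A (\<lambda>k. batch_op Fi (S k \<omega>)) (\<lambda>k. x k \<omega>) (\<lambda>k. xh k \<omega>)"
      by (rule AE_I2) (rule rule(2))
    show "AE \<omega> in M. \<forall>k. \<gamma> k \<omega> \<ge> min \<gamma>m1 (A / (\<beta> * L)) / sqrt (real k + 1)"
      by (rule AE_I2) (use rule(3) in blast)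
  }
qed

end
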